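(* Let $\Lambda=(\Lambda_i)_{i\in I}$ be a repetitive Meyer multiple set of $\mathbb{R}^d$, let $\Gamma$ be the subgroup of $\mathbb{R}^d$ generated by its support $S(\Lambda)$, and let $(\mathsf{H},\Gamma,s_{\mathsf{H}})$ and $(\mathsf{W}_i)_{i\in I}$ be the cut and project scheme and window associated with $\Lambda$ as described in the context. Define the point pattern $\underline{\Lambda}=(\underline{\Lambda}_i)_{i\in I}$ by $$\underline{\Lambda}_i := \mathfrak{P}_{\mathsf{H}}(\mathring{\mathsf{W}}_i)\cup \Lambda_i ,\qquad i\in I,$$ where $\mathring{\mathsf{W}}_i$ is the interior of $\mathsf{W}_i$ in $\mathsf{H}$. Then $\underline{\Lambda}$ is a model multiple set, and whenever $\Delta=(\Delta_i)_{i\in I}$ is a model multiple set of $\mathbb{R}^d$ with $\Lambda_i\subseteq\Delta_i$ for all $i\in I$, one has $$\Lambda_i\subseteq\underline{\Lambda}_i\subseteq\Delta_i\qquad\text{for all } i\in I.$$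
   Context: **Meyer multiple sets.** A Delone set of $\mathbb{R}^d$ is a uniformly discrete and relatively dense subset. A Meyer set is a Delone set $L$ for which there is a finite $F\subset\mathbb{R}^d$ with $L-L\subseteq L+F$. A Meyer multiple set is a finite family $\Lambda=(\Lambda_i)_{i\in I}$ of Meyer sets whose support $S(\Lambda):=\bigcup_{i\in I}\Lambda_i$ is again a Meyer set. **Hull, repetitivity.** $B_R$ is the Euclidean ball of radius $R$ (centred at $0$). For a family $P=(P_i)_{i\in I}$ of subsets of $\mathbb{R}^d$ and $t\in\mathbb{R}^d$ put $P\pm t:=(P_i\pm t)_{i\in I}$, $P\cap B_R:=(P_i\cap B_R)_{i\in I}$, $S(P):=\bigcup_i P_i$. The hull $\mathbb{X}_\Lambda$ is the set of all families $P=(P_i)_{i\in I}$ of subsets of $\mathbb{R}^d$ such that for every $R>0$ there is $t\in\mathbb{R}^d$ with $P\cap B_R=(\Lambda-t)\cap B_R$. $\mathbb{R}^d$ acts on $\mathbb{X}_\Lambda$ by $P\mapsto P-t$. The local topology on $\mathbb{X}_\Lambda$ is the (compact) topology given by the uniformity with basis $\{(P,P') : \exists\, s,s'\in B_\varepsilon,\ (P-s)\cap B_R=(P'-s')\cap B_R\}$, $R,\varepsilon>0$. $\Lambda$ is repetitive if the action of $\mathbb{R}^d$ on $\mathbb{X}_\Lambda$ with the local topology is minimal (every orbit is dense). The combinatorial topology on $\mathbb{X}_\Lambda$ is the one given by the uniformity with basis $\mathcal{U}_R:=\{(P,P') : P\cap B_R=P'\cap B_R\}$, $R>0$. **Cut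 and project schemes and model sets.** A cut and project scheme (CPS) is a triple $(H,\Gamma,s_H)$ where $H$ is a locally compact $\sigma$-compact (Hausdorff) abelian group (LCA group), $\Gamma$ is a countable subgroup of $\mathbb{R}^d$, and $s_H:\Gamma\to H$ is a group morphism with dense range whose graph $\{(s_H(\gamma),\gamma):\gamma\in\Gamma\}$ is a lattice (discrete co-compact subgroup) in $H\times\mathbb{R}^d$. For $W\subseteq H$ put $\mathfrak{P}_H(W):=\{\gamma\in\Gamma : s_H(\gamma)\in W\}$. A window in $H$ is a finite family $(W_i)_{i\in I}$ of compact topologically regular subsets of $H$ (each is compact and is the closure of its interior $\mathring{W}_i$). A model multiple set is a family $(\Delta_i)_{i\in I}$ of subsets of $\mathbb{R}^d$ for which there exist a CPS $(H,\Gamma,s_H)$ and a window $(W_i)_{i\in I}$ in $H$ with $\mathfrak{P}_H(\mathring{W}_i)\subseteq\Delta_i\subseteq\mathfrak{P}_H(W_i)$ for all $i\in I$. **The CPS and window associated with a repetitive Meyer multiple set $\Lambda$.** Let $\Gamma$ be the (countable) subgroup of $\mathbb{R}^d$ generated by $S(\Lambda)$, and let $\Xi^\Gamma:=\{P\in\mathbb{X}_\Lambda : S(P)\subseteq\Gamma\}$ with the combinatorial topology. Let $\Xi_i:=\{P\in\mathbb{X}_\Lambda : 0\in P_i\}$; one has $\Xi_i\subseteq\Xi^\Gamma$. Two elements $P,P'\in\mathbb{X}_\Lambda$ are strongly regionally proximal, $P\sim_{srp}P'$, if for each $R>0$ there are $P^1,P^2\in\mathbb{X}_\Lambda$ and $t\in\mathbb{R}^d$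 with $P\cap B_R=P^1\cap B_R$, $P'\cap B_R=P^2\cap B_R$ and $(P^1-t)\cap B_R=(P^2-t)\cap B_R$. The following facts are known for repetitive Meyer multiple sets: $\sim_{srp}$ is an equivalence relation, and the class $[P]_{srp}$ of any $P\in\Xi^\Gamma$ is contained in $\Xi^\Gamma$; the quotient space $\mathsf{H}:=\Xi^\Gamma/\!\sim_{srp}$ with quotient topology carries a LCA group structure for which $s_{\mathsf{H}}:\Gamma\to\mathsf{H}$, $s_{\mathsf{H}}(\gamma):=[\Lambda+\gamma]_{srp}$, is a group morphism (with dense range, which determines the group structure); $(\mathsf{H},\Gamma,s_{\mathsf{H}})$ is a CPS; the sets $\mathsf{W}_i:=-[\Xi_i]_{srp}$ (the negatives in $\mathsf{H}$ of the images of the $\Xi_i$) are compact and topologically regular in $\mathsf{H}$, thus form a window; and $\Lambda_i\subseteq\mathfrak{P}_{\mathsf{H}}(\mathsf{W}_i)=\bigcup_{P\in[\Lambda]_{srp}}P_i$ for each $i\in I$. *)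

theory Defs
  imports "HOL-Analysis.Analysis" "HOL-Algebra.Coset" "HOL-Algebra.Generated_Groups"
begin

definition uniformity_topology :: "'p set \<Rightarrow> ('p \<times> 'p) set set \<Rightarrow> 'p topology" where
  "uniformity_topology X B =
     topology (\<lambda>U. U \<subseteq> X \<and> (\<forall>x\<in>U. \<exists>E\<in>B. \<forall>y\<in>X. (x, y) \<in> E \<longrightarrow> y \<in> U))"

lemma openin_uniformity_topology:
  assumes "B \<noteq> {}" and dir: "\<And>E F. E \<in> B \<Longrightarrow> F \<in> B \<Longrightarrow> \<exists>D\<in>B. D \<subseteq> E \<inter> F"
  shows "openin (uniformity_topology X B) U \<longleftrightarrow>
           U \<subseteq> X \<and> (\<forall>x\<in>U. \<exists>E\<in>B. \<forall>y\<in>X. (x, y) \<in> E \<longrightarrow> y \<in> U)"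
proof -
  let ?P = "\<lambda>U. U \<subseteq> X \<and> (\<forall>x\<in>U. \<exists>E\<in>B. \<forall>y\<in>X. (x, y) \<in> E \<longrightarrow> y \<in> U)"
  have "istopology ?P"
    unfolding istopology_def
  proof (intro conjI allI impI)
    fix S T assume S: "?P S" and T: "?P T"
    show "S \<inter> T \<subseteq> X" using S by blast
    show "\<forall>x\<in>S \<inter> T. \<exists>E\<in>B. \<forall>y\<in>X. (x, y) \<in> E \<longrightarrow> y \<in> S \<inter> T"
    proof
      fix x assume x: "x \<in> S \<inter> T"
      obtain E F where "E \<in> B" "F \<in> B"
        and "\<forall>y\<in>X. (x, y) \<in> E \<longrightarrow> y \<in> S" "\<forall>y\<in>X. (x, y) \<in> F \<longrightarrow> y \<in> T"
        using S T x by (metis IntE)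
      then show "\<exists>E\<in>B. \<forall>y\<in>X. (x, y) \<in> E \<longrightarrow> y \<in> S \<inter> T"
        using dir[of E F] by blast
    qed
  next
    fix K assume K: "\<forall>S\<in>K. ?P S"
    show "\<Union>K \<subseteq> X" using K by blast
    show "\<forall>x\<in>\<Union>K. \<exists>E\<in>B. \<forall>y\<in>X. (x, y) \<in> E \<longrightarrow> y \<in> \<Union>K"
    proof
      fix x assume "x \<in> \<Union>K"
      then obtain S where S: "S \<in> K" "x \<in> S" by blast
      with K obtain E where "E \<in> B" "\<forall>y\<in>X. (x, y) \<in> E \<longrightarrow> y \<in> S" by blast
      then show "\<exists>E\<in>B. \<forall>y\<in>X. (x, y) \<in> E \<longrightarrow> y \<in> \<Union>K" using S(1) by blast
    qed
  qed
  then show ?thesis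
    unfolding uniformity_topology_def by (simp add: topology_inverse')
qed

definition quotient_topology :: "'p topology \<Rightarrow> ('p \<Rightarrow> 'q) \<Rightarrow> 'q topology" where
  "quotient_topology T f =
     topology (\<lambda>U. U \<subseteq> f ` topspace T \<and> openin T {x \<in> topspace T. f x \<in> U})"

lemma openin_quotient_topology:
  "openin (quotient_topology T f) U \<longleftrightarrow>
     U \<subseteq> f ` topspace T \<and> openin T {x \<in> topspace T. f x \<in> U}"
proof -
  let ?P = "\<lambda>U. U \<subseteq> f ` topspace T \<and> openin T {x \<in> topspace T. f x \<in> U}"
  have "istopology ?P"
    unfolding istopology_def
  proof (intro conjI allI impI)
    fix R S assume "?P R" "?P S"
    then show "R \<inter> S \<subseteq> f ` topspace T" by blast
    have eq: "{x \<in> topspace T. f x \<in> R \<inter> S} =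
          {x \<in> topspace T. f x \<in> R} \<inter> {x \<in> topspace T. f x \<in> S}" by blast
    show "openin T {x \<in> topspace T. f x \<in> R \<inter> S}"
      unfolding eq using \<open>?P R\<close> \<open>?P S\<close> by (intro openin_Int) simp_all
  next
    fix K assume K: "\<forall>S\<in>K. ?P S"
    then show "\<Union>K \<subseteq> f ` topspace T" by blast
    have "{x \<in> topspace T. f x \<in> \<Union>K} = (\<Union>S\<in>K. {x \<in> topspace T. f x \<in> S})" by blast
    moreover have "openin T (\<Union>S\<in>K. {x \<in> topspace T. f x \<in> S})"
      using K by (intro openin_Union) auto
    ultimately show "openin T {x \<in> topspace T. f x \<in> \<Union>K}" by simp
  qed
  then show ?thesis
    unfolding quotient_topology_def by (simp add: topology_inverse')
qed

lemma topspace_quotient_topology: "topspace (quotient_topology T f) = f ` topspace T"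
proof
  show "topspace (quotient_topology T f) \<subseteq> f ` topspace T"
    using openin_topspace[of "quotient_topology T f"] unfolding openin_quotient_topology
    by (rule conjunct1)
  have "{x \<in> topspace T. f x \<in> f ` topspace T} = topspace T" by blast
  then show "f ` topspace T \<subseteq> topspace (quotient_topology T f)"
    by (intro openin_subset) (simp add: openin_quotient_topology)
qed

lemma quotient_map_quotient_topology: "quotient_map T (quotient_topology T f) f"
  by (simp add: quotient_map_def topspace_quotient_topology openin_quotient_topology)

definition relatively_dense :: "'a::metric_space set \<Rightarrow> bool" where
  "relatively_dense L \<longleftrightarrow> (\<exists>R>0. \<forall>x. \<exists>y\<in>L. dist x y \<le> R)"

definition delone_set :: "'a::metric_space set \<Rightarrow> bool" where
  "delone_set L \<longleftrightarrow> uniform_discrete L \<and> relatively_dense L"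

definition meyer_set :: "'a::euclidean_space set \<Rightarrow> bool" where
  "meyer_set L \<longleftrightarrow> delone_set L \<and>
     (\<exists>F. finite F \<and> {x - y |x y. x \<in> L \<and> y \<in> L} \<subseteq> {x + f |x f. x \<in> L \<and> f \<in> F})"

definition support :: "('i \<Rightarrow> 'a set) \<Rightarrow> 'a set" where
  "support P = (\<Union>i. P i)"

definition meyer_multiple_set :: "('i::finite \<Rightarrow> 'a::euclidean_space set) \<Rightarrow> bool" where
  "meyer_multiple_set \<Lambda> \<longleftrightarrow> (\<forall>i. meyer_set (\<Lambda> i)) \<and> meyer_set (support \<Lambda>)"

definition translate :: "('i \<Rightarrow> 'a::ab_group_add set) \<Rightarrow> 'a \<Rightarrow> 'i \<Rightarrow> 'a set" where
  "translate P t = (\<lambda>i. (\<lambda>x. x + t) ` P i)"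

text \<open>
  Balls are taken closed.  Every notion below quantifies over all radii, so open balls would give
  the same hull, topologies and proximality relation.
\<close>

definition restrict_ball :: "('i \<Rightarrow> 'a::real_normed_vector set) \<Rightarrow> real \<Rightarrow> 'i \<Rightarrow> 'a set" where
  "restrict_ball P R = (\<lambda>i. P i \<inter> cball 0 R)"

definition hull_of :: "('i \<Rightarrow> 'a::euclidean_space set) \<Rightarrow> ('i \<Rightarrow> 'a set) set" where
  "hull_of \<Lambda> = {P. \<forall>R>0. \<exists>t. restrict_ball P R = restrict_ball (translate \<Lambda> (- t)) R}"

definition local_entourage ::
    "real \<Rightarrow> real \<Rightarrow> (('i \<Rightarrow> 'a::euclidean_space set) \<times> ('i \<Rightarrow> 'a set)) set" where
  "local_entourage R \<epsilon> =
     {(P, P'). \<exists>s\<in>cball 0 \<epsilon>. \<exists>s'\<in>cball 0 \<epsilon>.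
        restrict_ball (translate P (- s)) R = restrict_ball (translate P' (- s')) R}"

definition local_topology ::
    "('i \<Rightarrow> 'a::euclidean_space set) \<Rightarrow> ('i \<Rightarrow> 'a set) topology" where
  "local_topology \<Lambda> =
     uniformity_topology (hull_of \<Lambda>) {local_entourage R \<epsilon> |R \<epsilon>. R > 0 \<and> \<epsilon> > 0}"

definition repetitive :: "('i \<Rightarrow> 'a::euclidean_space set) \<Rightarrow> bool" where
  "repetitive \<Lambda> \<longleftrightarrow>
     (\<forall>P\<in>hull_of \<Lambda>. local_topology \<Lambda> closure_of range (\<lambda>t. translate P (- t)) = hull_of \<Lambda>)"

definition comb_entourage ::
    "real \<Rightarrow> (('i \<Rightarrow> 'a::euclidean_space set) \<times> ('i \<Rightarrow> 'a set)) set" where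
  "comb_entourage R = {(P, P'). restrict_ball P R = restrict_ball P' R}"

definition comb_topology ::
    "('i \<Rightarrow> 'a::euclidean_space set) \<Rightarrow> ('i \<Rightarrow> 'a set) topology" where
  "comb_topology \<Lambda> = uniformity_topology (hull_of \<Lambda>) {comb_entourage R |R. R > 0}"

lemma restrict_ball_mono_eq:
  assumes "restrict_ball P R = restrict_ball Q R" and "r \<le> R"
  shows "restrict_ball P r = restrict_ball Q r"
proof
  fix i
  have "P i \<inter> cball 0 R = Q i \<inter> cball 0 R"
    using assms(1) by (metis restrict_ball_def)
  moreover have "cball 0 r \<subseteq> cball (0::'b) R" using assms(2) by (rule subset_cball)
  ultimately show "restrict_ball P r i = restrict_ball Q r i"
    unfolding restrict_ball_def by blast
qed

lemma openin_local_topology: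
  "openin (local_topology \<Lambda>) U \<longleftrightarrow> U \<subseteq> hull_of \<Lambda> \<and>
     (\<forall>P\<in>U. \<exists>R>0. \<exists>\<epsilon>>0. \<forall>P'\<in>hull_of \<Lambda>. (P, P') \<in> local_entourage R \<epsilon> \<longrightarrow> P' \<in> U)"
proof -
  let ?B = "{local_entourage R \<epsilon> |R \<epsilon>. R > 0 \<and> \<epsilon> > 0} ::
    (('a \<Rightarrow> 'b set) \<times> ('a \<Rightarrow> 'b set)) set set"
  have mono: "local_entourage R \<epsilon> \<subseteq> (local_entourage r \<delta> :: (('a \<Rightarrow> 'b set) \<times> ('a \<Rightarrow> 'b set)) set)"
    if "r \<le> R" "\<epsilon> \<le> \<delta>" for R r \<epsilon> \<delta>
  proof -
    have "cball 0 \<epsilon> \<subseteq> cball (0::'b) \<delta>" using that(2) by (rule subset_cball)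
    then show ?thesis
      unfolding local_entourage_def using restrict_ball_mono_eq[OF _ that(1)] by blast
  qed
  have ne: "?B \<noteq> {}" using zero_less_one by blast
  have dir: "\<exists>D\<in>?B. D \<subseteq> E \<inter> F" if EF: "E \<in> ?B" "F \<in> ?B" for E F
  proof -
    obtain R \<epsilon> where E: "E = local_entourage R \<epsilon>" "R > 0" "\<epsilon> > 0" using EF(1) by blast
    obtain r \<delta> where F: "F = local_entourage r \<delta>" "r > 0" "\<delta> > 0" using EF(2) by blast
    have "local_entourage (max R r) (min \<epsilon> \<delta>) \<in> ?B" using E F by force
    moreover have "local_entourage (max R r) (min \<epsilon> \<delta>) \<subseteq> E \<inter> F"
      using E(1) F(1) by (simp add: mono)
    ultimately show ?thesis by blast
  qed
  have "openin (uniformity_topology (hull_of \<Lambda>) ?B) U \<longleftrightarrow> U \<subseteq> hull_of \<Lambda> \<and>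
      (\<forall>P\<in>U. \<exists>E\<in>?B. \<forall>P'\<in>hull_of \<Lambda>. (P, P') \<in> E \<longrightarrow> P' \<in> U)"
    by (rule openin_uniformity_topology[OF ne]) (rule dir)
  moreover have "(\<exists>E\<in>?B. \<forall>P'\<in>hull_of \<Lambda>. (P, P') \<in> E \<longrightarrow> P' \<in> U) \<longleftrightarrow>
      (\<exists>R>0. \<exists>\<epsilon>>0. \<forall>P'\<in>hull_of \<Lambda>. (P, P') \<in> local_entourage R \<epsilon> \<longrightarrow> P' \<in> U)" for P
    by blast
  ultimately show ?thesis unfolding local_topology_def by presburger
qed

lemma openin_comb_topology:
  "openin (comb_topology \<Lambda>) U \<longleftrightarrow> U \<subseteq> hull_of \<Lambda> \<and>
     (\<forall>P\<in>U. \<exists>R>0. \<forall>P'\<in>hull_of \<Lambda>. (P, P') \<in> comb_entourage R \<longrightarrow> P' \<in> U)"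
proof -
  let ?B = "{comb_entourage R |R. R > 0} :: (('a \<Rightarrow> 'b set) \<times> ('a \<Rightarrow> 'b set)) set set"
  have mono: "comb_entourage R \<subseteq> (comb_entourage r :: (('a \<Rightarrow> 'b set) \<times> ('a \<Rightarrow> 'b set)) set)"
    if "r \<le> R" for R r
    unfolding comb_entourage_def using restrict_ball_mono_eq[OF _ that] by blast
  have ne: "?B \<noteq> {}" using zero_less_one by blast
  have dir: "\<exists>D\<in>?B. D \<subseteq> E \<inter> F" if EF: "E \<in> ?B" "F \<in> ?B" for E F
  proof -
    obtain R where E: "E = comb_entourage R" "R > 0" using EF(1) by blast
    obtain r where F: "F = comb_entourage r" "r > 0" using EF(2) by blast
    have "comb_entourage (max R r) \<in> ?B" using E F by force
    moreover have "comb_entourage (max R r) \<subseteq> E \<inter> F"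
      using E(1) F(1) by (simp add: mono)
    ultimately show ?thesis by blast
  qed
  have "openin (uniformity_topology (hull_of \<Lambda>) ?B) U \<longleftrightarrow> U \<subseteq> hull_of \<Lambda> \<and>
      (\<forall>P\<in>U. \<exists>E\<in>?B. \<forall>P'\<in>hull_of \<Lambda>. (P, P') \<in> E \<longrightarrow> P' \<in> U)"
    by (rule openin_uniformity_topology[OF ne]) (rule dir)
  moreover have "(\<exists>E\<in>?B. \<forall>P'\<in>hull_of \<Lambda>. (P, P') \<in> E \<longrightarrow> P' \<in> U) \<longleftrightarrow>
      (\<exists>R>0. \<forall>P'\<in>hull_of \<Lambda>. (P, P') \<in> comb_entourage R \<longrightarrow> P' \<in> U)" for P
    by blast
  ultimately show ?thesis unfolding comb_topology_def by presburger
qed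

text \<open>
  Groups are HOL-Algebra structures, hence written multiplicatively; \<open>additive_group\<close> is the
  ambient Euclidean space in this form.
\<close>

definition additive_group :: "'a::ab_group_add monoid" where
  "additive_group = \<lparr>carrier = UNIV, mult = (+), one = 0\<rparr>"

definition sigma_compact_space :: "'h topology \<Rightarrow> bool" where
  "sigma_compact_space T \<longleftrightarrow>
     (\<exists>K :: nat \<Rightarrow> 'h set. (\<forall>n. compactin T (K n)) \<and> (\<Union>n. K n) = topspace T)"

definition lca_group :: "'h monoid \<Rightarrow> 'h topology \<Rightarrow> bool" where
  "lca_group H T \<longleftrightarrow>
     comm_group H \<and> topspace T = carrier H \<and>
     continuous_map (prod_topology T T) T (\<lambda>(x, y). x \<otimes>\<^bsub>H\<^esub> y) \<and>
     continuous_map T T (\<lambda>x. inv\<^bsub>H\<^esub> x) \<and>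
     Hausdorff_space T \<and> locally_compact_space T \<and> sigma_compact_space T"

definition lattice_in :: "'g monoid \<Rightarrow> 'g topology \<Rightarrow> 'g set \<Rightarrow> bool" where
  "lattice_in G T L \<longleftrightarrow>
     subgroup L G \<and> subtopology T L = discrete_topology L \<and>
     compact_space (quotient_topology T (\<lambda>x. L #>\<^bsub>G\<^esub> x))"

definition cut_project_scheme ::
    "'h monoid \<Rightarrow> 'h topology \<Rightarrow> 'a::euclidean_space set \<Rightarrow> ('a \<Rightarrow> 'h) \<Rightarrow> bool" where
  "cut_project_scheme H T \<Gamma> s \<longleftrightarrow>
     lca_group H T \<and>
     countable \<Gamma> \<and> subgroup \<Gamma> additive_group \<and>
     s \<in> hom (additive_group\<lparr>carrier := \<Gamma>\<rparr>) H \<and>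
     T closure_of (s ` \<Gamma>) = topspace T \<and>
     lattice_in (H \<times>\<times> additive_group) (prod_topology T euclidean) ((\<lambda>\<gamma>. (s \<gamma>, \<gamma>)) ` \<Gamma>)"

definition cut_project_set :: "'a set \<Rightarrow> ('a \<Rightarrow> 'h) \<Rightarrow> 'h set \<Rightarrow> 'a set" where
  "cut_project_set \<Gamma> s W = {\<gamma> \<in> \<Gamma>. s \<gamma> \<in> W}"

definition window :: "'h topology \<Rightarrow> ('i::finite \<Rightarrow> 'h set) \<Rightarrow> bool" where
  "window T W \<longleftrightarrow>
     (\<forall>i. compactin T (W i) \<and> T closure_of (T interior_of W i) = W i)"

text \<open>
  HOL cannot quantify existentially over types, so the type containing the carrier of the
  internal group is a parameter.  A statement about all model multiple sets is one for
  arbitrary \<open>'h\<close>.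
\<close>

definition model_multiple_set ::
    "'h itself \<Rightarrow> ('i::finite \<Rightarrow> 'a::euclidean_space set) \<Rightarrow> bool" where
  "model_multiple_set _ \<Delta> \<longleftrightarrow>
     (\<exists>(H :: 'h monoid) T \<Gamma> s W.
        cut_project_scheme H T \<Gamma> s \<and> window T W \<and>
        (\<forall>i. cut_project_set \<Gamma> s (T interior_of W i) \<subseteq> \<Delta> i \<and>
             \<Delta> i \<subseteq> cut_project_set \<Gamma> s (W i)))"

definition support_group :: "('i \<Rightarrow> 'a::euclidean_space set) \<Rightarrow> 'a set" where
  "support_group \<Lambda> = generate additive_group (support \<Lambda>)"

definition Xi_group :: "('i \<Rightarrow> 'a::euclidean_space set) \<Rightarrow> ('i \<Rightarrow> 'a set) set" where
  "Xi_group \<Lambda> = {P \<in> hull_of \<Lambda>. support P \<subseteq> support_group \<Lambda>}"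

definition Xi :: "('i \<Rightarrow> 'a::euclidean_space set) \<Rightarrow> 'i \<Rightarrow> ('i \<Rightarrow> 'a set) set" where
  "Xi \<Lambda> i = {P \<in> hull_of \<Lambda>. 0 \<in> P i}"

definition srp ::
    "('i \<Rightarrow> 'a::euclidean_space set) \<Rightarrow> ('i \<Rightarrow> 'a set) \<Rightarrow> ('i \<Rightarrow> 'a set) \<Rightarrow> bool" where
  "srp \<Lambda> P P' \<longleftrightarrow> P \<in> hull_of \<Lambda> \<and> P' \<in> hull_of \<Lambda> \<and>
     (\<forall>R>0. \<exists>P1\<in>hull_of \<Lambda>. \<exists>P2\<in>hull_of \<Lambda>. \<exists>t.
        restrict_ball P R = restrict_ball P1 R \<and>
        restrict_ball P' R = restrict_ball P2 R \<and>
        restrict_ball (translate P1 (- t)) R = restrict_ball (translate P2 (- t)) R)"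

definition srp_class ::
    "('i \<Rightarrow> 'a::euclidean_space set) \<Rightarrow> ('i \<Rightarrow> 'a set) \<Rightarrow> ('i \<Rightarrow> 'a set) set" where
  "srp_class \<Lambda> P = {P'. srp \<Lambda> P P'}"

definition srp_topology ::
    "('i \<Rightarrow> 'a::euclidean_space set) \<Rightarrow> ('i \<Rightarrow> 'a set) set topology" where
  "srp_topology \<Lambda> =
     quotient_topology (subtopology (comb_topology \<Lambda>) (Xi_group \<Lambda>)) (srp_class \<Lambda>)"

definition srp_map ::
    "('i \<Rightarrow> 'a::euclidean_space set) \<Rightarrow> 'a \<Rightarrow> ('i \<Rightarrow> 'a set) set" where
  "srp_map \<Lambda> \<gamma> = srp_class \<Lambda> (translate \<Lambda> \<gamma>)"

text \<open>
  \<open>srp_group \<Lambda> H\<close>: the structure \<open>H\<close> is the group structure on the quotient space.  Its carrier and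
  topology are concrete; the operation is pinned down by the requirement that \<open>srp_map \<Lambda>\<close> be a
  morphism, since the orbit of \<open>\<Lambda>\<close> has dense image.
\<close>

definition srp_group ::
    "('i \<Rightarrow> 'a::euclidean_space set) \<Rightarrow> ('i \<Rightarrow> 'a set) set monoid \<Rightarrow> bool" where
  "srp_group \<Lambda> H \<longleftrightarrow>
     carrier H = srp_class \<Lambda> ` Xi_group \<Lambda> \<and>
     lca_group H (srp_topology \<Lambda>) \<and>
     srp_map \<Lambda> \<in> hom (additive_group\<lparr>carrier := support_group \<Lambda>\<rparr>) H"

definition srp_window ::
    "('i \<Rightarrow> 'a::euclidean_space set) \<Rightarrow> ('i \<Rightarrow> 'a set) set monoid \<Rightarrow> 'i \<Rightarrow> ('i \<Rightarrow> 'a set) set set"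
  where "srp_window \<Lambda> H i = (\<lambda>P. inv\<^bsub>H\<^esub> (srp_class \<Lambda> P)) ` Xi \<Lambda> i"

definition lower_model ::
    "('i \<Rightarrow> 'a::euclidean_space set) \<Rightarrow> ('i \<Rightarrow> 'a set) set monoid \<Rightarrow> 'i \<Rightarrow> 'a set" where
  "lower_model \<Lambda> H i =
     cut_project_set (support_group \<Lambda>) (srp_map \<Lambda>) (srp_topology \<Lambda> interior_of srp_window \<Lambda> H i)
     \<union> \<Lambda> i"

end

(*
  Lambda is compared with a competing scheme (H', Gamma', s') and window W' through the closures V i
  of s' ` Lambda i, which lie in W' i.

  First, s gamma in srp_window i implies s' gamma in V i.  Unwinding strong regional proximality
  and using uniform recurrence of Lambda, one can write gamma = a + q - p - w with a in Lambda i and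
  p, q, w returning large patches of Lambda to themselves.  The images under s' of such return
  vectors accumulate only at a set G with V i + G contained in V i; by compactness translation
  by g in G is then a bijection of V i, so the contributions of p, q, w can be absorbed.
  There need not be a continuous homomorphism from H to H' extending s gamma |-> s' gamma: the
  sets V i may have common periods, and then s' is not continuous with respect to s.

  Second, interiors are mapped to interiors.  For a neighbourhood U of the identity the set of
  gamma with s gamma in U is relatively dense, so finitely many translates of the closure of
  its image under s' cover a neighbourhood of the identity of H', and this closure has interior.

  The same Baire argument, with the translates of a cylinder, gives the regularity of the
  window associated with Lambda and the discreteness of the graph of s.
*)
theory Submission
  imports Defs
begin

section \<open>Locally compact abelian groups\<close>

text \<open>The vector \<open>t\<close> in the definition of strong regional proximality is
  unbounded, so a patch that two patterns share near \<open>t\<close> says nothing directly about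
  their images under \<open>s'\<close>. Recurrence repairs this: within bounded distance of the
  shared patch one pattern repeats the central patch of \<Lambda>, hence so does the other, and the
  two long vectors leading there are the return vectors \<open>q\<close> and \<open>p\<close>. The
  third one, \<open>w\<close>, is the error made in replacing \<Lambda> - \<gamma> by another
  translate with the same large central patch. Finiteness has two sources. The Meyer inclusion for
  differences enters through the local finiteness of \<open>D2\<close>: it leaves finitely many
  patches of given radius through a fixed point, hence compact sets \<open>Xi\<close>, and it
  separates the graph of \<open>s\<close> near zero. For the competing scheme, discreteness of its
  lattice yields the finitely many translates of the interior argument. The group law on the
  quotient is prescribed only along the orbit of \<Lambda>; density and continuity carry it to all
  classes.\<close>

locale lca = comm_group H for H :: "'h monoid" (structure) and T :: "'h topology" +
  assumes lca: "lca_group H T"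
begin

lemma topspace [simp]: "topspace T = carrier H"
  using lca by (simp add: lca_group_def)

lemma hausdorff: "Hausdorff_space T"
  using lca by (simp add: lca_group_def)

lemma locally_compact: "locally_compact_space T"
  using lca by (simp add: lca_group_def)

lemma regular: "regular_space T"
  using hausdorff locally_compact locally_compact_Hausdorff_imp_regular_space by blast

lemma continuous_mult:
  assumes "continuous_map X T f" "continuous_map X T g"
  shows "continuous_map X T (\<lambda>x. f x \<otimes> g x)"
proof -
  have "continuous_map X (prod_topology T T) (\<lambda>x. (f x, g x))"
    using assms by (simp add: continuous_map_pairedI)
  moreover have "continuous_map (prod_topology T T) T (\<lambda>(x, y). x \<otimes> y)"
    using lca by (simp add: lca_group_def)
  ultimately show ?thesis
    using continuous_map_compose by (fastforce simp: o_def)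
qed

lemma continuous_inv:
  assumes "continuous_map X T f"
  shows "continuous_map X T (\<lambda>x. inv (f x))"
proof -
  have "continuous_map T T (\<lambda>x. inv x)"
    using lca by (simp add: lca_group_def)
  then show ?thesis using continuous_map_compose[OF assms] by (fastforce simp: o_def)
qed

lemma openin_preimage_mult:
  assumes "openin T U" "a \<in> carrier H"
  shows "openin T {x \<in> carrier H. a \<otimes> x \<in> U}"
proof -
  have "continuous_map T T (\<lambda>x. a \<otimes> x)"
    using assms(2) by (intro continuous_mult) (auto simp: continuous_map_id[unfolded id_def])
  from openin_continuous_map_preimage[OF this assms(1)] show ?thesis by simp
qed

lemma openin_preimage_inv:
  assumes "openin T U"
  shows "openin T {x \<in> carrier H. inv x \<in> U}"
proof -
  have "continuous_map T T (\<lambda>x. inv x)"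
    by (intro continuous_inv) (auto simp: continuous_map_id[unfolded id_def])
  from openin_continuous_map_preimage[OF this assms(1)] show ?thesis by simp
qed

lemma closedin_preimage_mult:
  assumes "closedin T U" "a \<in> carrier H"
  shows "closedin T {x \<in> carrier H. a \<otimes> x \<in> U}"
proof -
  have "continuous_map T T (\<lambda>x. a \<otimes> x)"
    using assms(2) by (intro continuous_mult) (auto simp: continuous_map_id[unfolded id_def])
  from closedin_continuous_map_preimage[OF this assms(1)] show ?thesis by simp
qed

lemma compactin_image_mult:
  assumes "compactin T C" "a \<in> carrier H"
  shows "compactin T ((\<lambda>x. a \<otimes> x) ` C)"
proof -
  have "continuous_map T T (\<lambda>x. a \<otimes> x)"
    using assms(2) by (intro continuous_mult) (auto simp: continuous_map_id[unfolded id_def])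
  from image_compactin[OF assms(1) this] show ?thesis .
qed

lemma compactin_image_inv:
  assumes "compactin T C"
  shows "compactin T ((\<lambda>x. inv x) ` C)"
proof -
  have "continuous_map T T (\<lambda>x. inv x)"
    by (intro continuous_inv) (auto simp: continuous_map_id[unfolded id_def])
  from image_compactin[OF assms(1) this] show ?thesis .
qed

lemma compactin_diff:
  assumes "compactin T C" "compactin T D"
  shows "compactin T {c \<otimes> inv d |c d. c \<in> C \<and> d \<in> D}"
proof -
  have "compactin (prod_topology T T) (C \<times> D)"
    using assms by (simp add: compactin_Times)
  moreover have "continuous_map (prod_topology T T) T (\<lambda>p. fst p \<otimes> inv (snd p))"
    by (intro continuous_mult continuous_inv continuous_map_fst continuous_map_snd)
  ultimately have "compactin T ((\<lambda>p. fst p \<otimes> inv (snd p)) ` (C \<times> D))"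
    by (rule image_compactin)
  moreover have "(\<lambda>p. fst p \<otimes> inv (snd p)) ` (C \<times> D) = {c \<otimes> inv d |c d. c \<in> C \<and> d \<in> D}"
    by force
  ultimately show ?thesis by simp
qed

text \<open>Nearness of \<open>y\<close> to \<open>x\<close> is measured throughout by
  \<open>inv x \<otimes> y\<close>, so halving a neighbourhood takes this form; two applications
  control a product of three errors.\<close>

lemma nhd_diff:
  assumes "openin T U" "\<one> \<in> U"
  obtains V where "openin T V" "\<one> \<in> V" "\<And>x y. x \<in> V \<Longrightarrow> y \<in> V \<Longrightarrow> inv x \<otimes> y \<in> U"
proof -
  have "continuous_map (prod_topology T T) T (\<lambda>p. inv (fst p) \<otimes> snd p)"
    by (intro continuous_mult continuous_inv continuous_map_fst continuous_map_snd)
  define S where "S = {p \<in> carrier H \<times> carrier H. inv (fst p) \<otimes> snd p \<in> U}"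
  have o: "openin (prod_topology T T) S"
    using openin_continuous_map_preimage[OF \<open>continuous_map _ T _\<close> assms(1)] by (simp add: S_def)
  have "(\<one>, \<one>) \<in> S"
    using assms(2) by (simp add: S_def)
  from o[unfolded openin_prod_topology_alt, rule_format, OF this]
  obtain A B where AB: "openin T A" "openin T B" "\<one> \<in> A" "\<one> \<in> B" "A \<times> B \<subseteq> S"
    by (elim exE conjE)
  show ?thesis
  proof (rule that[of "A \<inter> B"])
    show "openin T (A \<inter> B)" using AB by blast
    show "\<one> \<in> A \<inter> B" using AB by blast
    fix x y assume "x \<in> A \<inter> B" "y \<in> A \<inter> B"
    then have "(x, y) \<in> A \<times> B" by blast
    then show "inv x \<otimes> y \<in> U" using AB(5) by (fastforce simp: S_def)
  qed
qed

lemma closure_nhd: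
  assumes "closedin T C" "x \<in> carrier H"
    and N: "\<And>N. openin T N \<Longrightarrow> \<one> \<in> N \<Longrightarrow> \<exists>c\<in>C. inv c \<otimes> x \<in> N"
  shows "x \<in> C"
proof (rule ccontr)
  assume "x \<notin> C"
  \<comment> \<open>\<open>?N\<close> consists of the \<open>y\<close> with
    \<open>x \<otimes> inv y\<close> outside \<open>C\<close>; at
    \<open>y = inv c \<otimes> x\<close> this product is \<open>c\<close>.\<close>
  let ?N = "{y \<in> carrier H. inv y \<in> {y \<in> carrier H. x \<otimes> y \<in> carrier H - C}}"
  have o: "openin T (carrier H - C)"
    using assms(1) by (metis openin_diff openin_topspace topspace)
  have "openin T ?N"
    by (intro openin_preimage_inv openin_preimage_mult o assms)
  moreover have "\<one> \<in> ?N" using assms(2) \<open>x \<notin> C\<close> by simp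
  ultimately obtain c where c: "c \<in> C" "inv c \<otimes> x \<in> ?N" using N by blast
  have cc: "c \<in> carrier H" using c(1) assms(1) closedin_subset by fastforce
  have "x \<otimes> inv (inv c \<otimes> x) = c"
    using cc assms(2) by (simp add: inv_mult_group m_assoc[symmetric])
  then show False using c by simp
qed

text \<open>The centres may be taken in a dense set because the \<open>f\<close> with
  \<open>inv f \<otimes> c \<in> N\<close> form an open set around \<open>c\<close>. Both the whole
  carrier and the image of \<Gamma> under \<open>s\<close> serve as \<open>A\<close>.\<close>

lemma compact_cover_nhd:
  assumes "compactin T C" "openin T N" "\<one> \<in> N"
    and dense: "T closure_of A = topspace T" and A: "A \<subseteq> carrier H"
  obtains F where "finite F" "F \<subseteq> A" "\<And>c. c \<in> C \<Longrightarrow> \<exists>f\<in>F. inv f \<otimes> c \<in> N"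
proof -
  define O' where "O' f = {x \<in> carrier H. inv f \<otimes> x \<in> N}" for f
  have op: "openin T (O' f)" if "f \<in> A" for f
    unfolding O'_def using that A by (intro openin_preimage_mult assms) auto
  have "C \<subseteq> \<Union>(O' ` A)"
  proof
    fix c assume "c \<in> C"
    then have c: "c \<in> carrier H" using assms(1) compactin_subset_topspace by fastforce
    have "openin T {x \<in> carrier H. inv c \<otimes> x \<in> {x \<in> carrier H. inv x \<in> N}}"
      using c by (intro openin_preimage_mult openin_preimage_inv assms) auto
    moreover have "c \<in> {x \<in> carrier H. inv c \<otimes> x \<in> {x \<in> carrier H. inv x \<in> N}}"
      using c assms(3) by simp
    ultimately obtain f where f: "f \<in> A" "inv (inv c \<otimes> f) \<in> N"
      using dense unfolding dense_intersects_open by blast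
    then have "inv f \<otimes> c \<in> N" using c A by (simp add: inv_mult_group subset_iff)
    then show "c \<in> \<Union>(O' ` A)" using f c unfolding O'_def by blast
  qed
  then obtain \<F> where "finite \<F>" "\<F> \<subseteq> O' ` A" "C \<subseteq> \<Union>\<F>"
    using assms(1) op unfolding compactin_def by (metis (no_types, lifting) imageE)
  then obtain F where "finite F" "F \<subseteq> A" "C \<subseteq> \<Union>(O' ` F)"
    by (metis finite_subset_image)
  then show ?thesis by (intro that[of F]) (auto simp: O'_def)
qed

lemma Baire_cover:
  assumes "countable \<G>" "\<And>C. C \<in> \<G> \<Longrightarrow> closedin T C"
    and "openin T U" "U \<noteq> {}" "U \<subseteq> \<Union>\<G>"
  obtains C where "C \<in> \<G>" "T interior_of C \<noteq> {}"
proof -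
  have "T interior_of \<Union>\<G> \<noteq> {}"
    using assms(3-5) interior_of_maximal by blast
  then show ?thesis
    using Baire_category_alt[of T \<G>] locally_compact regular assms that by blast
qed

lemma compact_nhd:
  obtains V K where "openin T V" "\<one> \<in> V" "compactin T K" "V \<subseteq> K"
proof -
  have "\<one> \<in> topspace T" by simp
  with locally_compact obtain V K where "openin T V" "compactin T K" "\<one> \<in> V" "V \<subseteq> K"
    unfolding locally_compact_space_def by blast
  then show ?thesis by (intro that)
qed

lemma compactin_closedin: "compactin T C \<Longrightarrow> closedin T C"
  using hausdorff compactin_imp_closedin by blast

text \<open>
  A translation mapping a compact set into itself maps it onto itself: by pigeonhole some positive
  power of \<open>g\<close> is close to the identity.
\<close>

lemma compact_semistable:
  assumes V: "compactin T V" and g: "g \<in> carrier H" and gV: "\<And>v. v \<in> V \<Longrightarrow> v \<otimes> g \<in> V"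
    and v: "v \<in> V"
  shows "v \<otimes> inv g \<in> V"
proof -
  have Vc: "V \<subseteq> carrier H" using V compactin_subset_topspace by fastforce
  have pow: "w \<otimes> g [^] (n::nat) \<in> V" if "w \<in> V" for w n
  proof (induction n)
    case (Suc n)
    have "w \<otimes> g [^] Suc n = (w \<otimes> g [^] n) \<otimes> g"
      using Vc that g by (simp add: m_assoc subset_iff)
    then show ?case using gV[OF Suc] by simp
  qed (use that Vc in auto)
  have vc: "v \<in> carrier H" using v Vc by blast
  show ?thesis
  proof (rule closure_nhd[OF compactin_closedin[OF V]])
    show "v \<otimes> inv g \<in> carrier H" using vc g by simp
    fix N assume N: "openin T N" "\<one> \<in> N"
    obtain M where M: "openin T M" "\<one> \<in> M" "\<And>x y. x \<in> M \<Longrightarrow> y \<in> M \<Longrightarrow> inv x \<otimes> y \<in> N"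
      using nhd_diff[OF N] by metis
    have "T closure_of carrier H = topspace T"
      using closure_of_topspace[of T] by simp
    from compact_cover_nhd[OF V M(1,2) this]
    obtain F where F: "finite F" "F \<subseteq> carrier H" "\<And>c. c \<in> V \<Longrightarrow> \<exists>f\<in>F. inv f \<otimes> c \<in> M"
      by blast
    have "\<forall>n. \<exists>f. f \<in> F \<and> inv f \<otimes> (v \<otimes> g [^] (n::nat)) \<in> M"
      using F(3) pow[OF v] by blast
    from choice[OF this]
    obtain h where h: "\<And>n. h n \<in> F" "\<And>n. inv (h n) \<otimes> (v \<otimes> g [^] (n::nat)) \<in> M"
      by blast
    have "\<not> inj h"
      using finite_subset[of "range h" F] F(1) h(1) finite_imageD[of h UNIV] infinite_UNIV_nat
      by blast
    then obtain m n where mn: "m < n" "h m = h n"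
      using linorder_injI[of h] by blast
    \<comment> \<open>The exponents differ by \<open>Suc k\<close>, with \<open>k = 0\<close>
      allowed, so \<open>v \<otimes> g [^] k\<close> is still in \<open>V\<close>; its quotient to
      \<open>v \<otimes> inv g\<close> is the inverse of \<open>g [^] Suc k\<close>, which is
      small.\<close>
    obtain k where k: "n = m + Suc k" using less_imp_Suc_add[OF mn(1)] by auto
    let ?f = "h m"
    have fc: "?f \<in> carrier H" using F(2) h(1) by blast
    have gm: "g [^] m \<in> carrier H" "g [^] k \<in> carrier H" using g by auto
    have "inv (inv ?f \<otimes> (v \<otimes> g [^] n)) \<otimes> (inv ?f \<otimes> (v \<otimes> g [^] m)) \<in> N"
      using M(3) h(2)[of n] h(2)[of m] mn(2) by simp
    also have "g [^] n = g [^] m \<otimes> (g [^] k \<otimes> g)"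
      unfolding k using g by (simp add: nat_pow_mult[symmetric] m_assoc)
    also have "inv (inv ?f \<otimes> (v \<otimes> (g [^] m \<otimes> (g [^] k \<otimes> g)))) \<otimes> (inv ?f \<otimes> (v \<otimes> g [^] m))
      = inv (g [^] k \<otimes> g)"
    proof -
      define a where "a = inv ?f \<otimes> (v \<otimes> g [^] m)"
      have a: "a \<in> carrier H" unfolding a_def using fc vc gm by simp
      have "inv ?f \<otimes> (v \<otimes> (g [^] m \<otimes> (g [^] k \<otimes> g))) = a \<otimes> (g [^] k \<otimes> g)"
        unfolding a_def using fc vc gm g by (simp add: m_assoc)
      then show ?thesis unfolding a_def[symmetric] using a gm g
        by (simp add: inv_mult_group m_assoc)
    qed
    also have "\<dots> = inv (v \<otimes> g [^] k) \<otimes> (v \<otimes> inv g)"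
    proof -
      have "inv v \<otimes> (v \<otimes> inv g) = inv g" using vc g by (simp add: m_assoc[symmetric])
      moreover have "inv (v \<otimes> g [^] k) \<otimes> (v \<otimes> inv g) = inv (g [^] k) \<otimes> (inv v \<otimes> (v \<otimes> inv g))"
        using vc gm g by (simp add: inv_mult_group m_assoc)
      moreover have "inv (g [^] k \<otimes> g) = inv (g [^] k) \<otimes> inv g"
        using gm g by (simp add: inv_mult)
      ultimately show ?thesis by simp
    qed
    finally show "\<exists>c\<in>V. inv c \<otimes> (v \<otimes> inv g) \<in> N"
      using pow[OF v] by blast
  qed
qed

end

lemma lcaI: "lca_group K T \<Longrightarrow> lca K T"
  by (simp add: lca_def lca_axioms_def lca_group_def)

section \<open>Patches and the hull\<close>

lemma finite_uniform_discrete_cball: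
  fixes S :: "'a::euclidean_space set"
  assumes "uniform_discrete S"
  shows "finite (S \<inter> cball a r)"
proof -
  have "uniform_discrete (S \<inter> cball a r)"
    using assms by (rule uniform_discrete_subset) simp
  then have "discrete (S \<inter> cball a r)" "compact (S \<inter> cball a r)"
    using uniform_discrete_imp_closed uniform_discrete_imp_discrete bounded_cball
      compact_eq_bounded_closed bounded_subset by (blast, metis inf_le2)
  then show ?thesis
    using discrete_compact_finite_iff by blast
qed

definition agree :: "real \<Rightarrow> ('i \<Rightarrow> 'a::real_normed_vector set) \<Rightarrow> ('i \<Rightarrow> 'a set) \<Rightarrow> bool" where
  "agree R P Q \<longleftrightarrow> (\<forall>i x. norm x \<le> R \<longrightarrow> (x \<in> P i \<longleftrightarrow> x \<in> Q i))"

lemma restrict_ball_eq_iff: "restrict_ball P R = restrict_ball Q R \<longleftrightarrow> agree R P Q"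
  unfolding restrict_ball_def agree_def fun_eq_iff set_eq_iff by auto

lemma agreeD: "agree R P Q \<Longrightarrow> norm x \<le> R \<Longrightarrow> x \<in> P i \<longleftrightarrow> x \<in> Q i"
  by (simp add: agree_def)

lemma agree_refl [simp]: "agree R P P"
  by (simp add: agree_def)

lemma agree_sym: "agree R P Q \<Longrightarrow> agree R Q P"
  by (simp add: agree_def)

lemma agree_trans: "agree R P Q \<Longrightarrow> agree R Q S \<Longrightarrow> agree R P S"
  by (simp add: agree_def)

lemma agree_mono: "agree R P Q \<Longrightarrow> r \<le> R \<Longrightarrow> agree r P Q"
  by (simp add: agree_def)

lemma agree_support: "agree R P Q \<Longrightarrow> norm x \<le> R \<Longrightarrow> x \<in> support P \<longleftrightarrow> x \<in> support Q"
  by (simp add: agree_def support_def)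

lemma mem_translate: "x \<in> translate P t i \<longleftrightarrow> x - t \<in> P i"
  unfolding translate_def by (auto simp: image_iff) (metis diff_add_cancel)

lemma mem_support_translate: "x \<in> support (translate P t) \<longleftrightarrow> x - t \<in> support P"
  by (simp add: support_def mem_translate)

lemma translate_translate [simp]: "translate (translate P s) t = translate P (s + t)"
  by (rule ext) (auto simp: mem_translate algebra_simps)

lemma translate_zero [simp]: "translate P 0 = P"
  by (rule ext) (auto simp: mem_translate)

lemma agree_translate:
  fixes P Q :: "'i \<Rightarrow> 'a::real_normed_vector set"
  assumes "agree R P Q" "r + norm t \<le> R"
  shows "agree r (translate P t) (translate Q t)"
  unfolding agree_def mem_translate
proof (intro allI impI)
  fix i and x :: 'a assume "norm x \<le> r"
  then have "norm (x - t) \<le> R" using assms(2) norm_triangle_ineq4[of x t] by linarith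
  then show "x - t \<in> P i \<longleftrightarrow> x - t \<in> Q i" by (rule agreeD[OF assms(1)])
qed

lemma hull_agree: "P \<in> hull_of \<Lambda> \<Longrightarrow> \<exists>t. agree R P (translate \<Lambda> (- t))"
proof -
  assume "P \<in> hull_of \<Lambda>"
  then have "\<forall>R>0. \<exists>t. agree R P (translate \<Lambda> (- t))"
    unfolding hull_of_def restrict_ball_eq_iff by simp
  moreover have "max R 1 > 0" by simp
  ultimately obtain t where "agree (max R 1) P (translate \<Lambda> (- t))" by blast
  then show ?thesis using agree_mono[of "max R 1" P _ R] by auto
qed

lemma hullI: "(\<And>R. \<exists>t. agree R P (translate \<Lambda> (- t))) \<Longrightarrow> P \<in> hull_of \<Lambda>"
  unfolding hull_of_def restrict_ball_eq_iff by simp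

lemma translate_self_hull: "translate \<Lambda> t \<in> hull_of \<Lambda>"
  by (rule hullI) (metis agree_refl add.inverse_inverse)

lemma translate_hull:
  assumes "P \<in> hull_of \<Lambda>" shows "translate P t \<in> hull_of \<Lambda>"
proof (rule hullI)
  fix R
  obtain s where "agree (R + norm t) P (translate \<Lambda> (- s))" using hull_agree[OF assms] by blast
  then have "agree R (translate P t) (translate \<Lambda> (- (s - t)))"
    using agree_translate[of "R + norm t" P "translate \<Lambda> (- s)" R t] by (simp add: algebra_simps)
  then show "\<exists>s. agree R (translate P t) (translate \<Lambda> (- s))" by blast
qed

text \<open>One ball shows both points, and there \<open>P\<close> is a single translate of
  \<Lambda>; the shift cancels in the difference.\<close>

lemma hull_diff:
  assumes "P \<in> hull_of \<Lambda>" "x \<in> support P" "y \<in> support P"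
  obtains a b where "a \<in> support \<Lambda>" "b \<in> support \<Lambda>" "x - y = a - b"
proof -
  obtain t where t: "agree (max (norm x) (norm y)) P (translate \<Lambda> (- t))"
    using hull_agree[OF assms(1)] by blast
  have "x + t \<in> support \<Lambda>" "y + t \<in> support \<Lambda>"
    using agree_support[OF t] assms(2,3) by (simp_all add: mem_support_translate)
  then show ?thesis using that[of "x + t" "y + t"] by simp
qed

lemma openin_comb:
  "openin (comb_topology \<Lambda>) U \<longleftrightarrow> U \<subseteq> hull_of \<Lambda> \<and>
     (\<forall>P\<in>U. \<exists>R. \<forall>P'\<in>hull_of \<Lambda>. agree R P P' \<longrightarrow> P' \<in> U)"
proof -
  have "(\<exists>R>0. \<forall>P'\<in>hull_of \<Lambda>. agree R P P' \<longrightarrow> P' \<in> U) \<longleftrightarrow>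
        (\<exists>R. \<forall>P'\<in>hull_of \<Lambda>. agree R P P' \<longrightarrow> P' \<in> U)" for P
  proof
    assume "\<exists>R. \<forall>P'\<in>hull_of \<Lambda>. agree R P P' \<longrightarrow> P' \<in> U"
    then obtain R where "\<forall>P'\<in>hull_of \<Lambda>. agree R P P' \<longrightarrow> P' \<in> U" by blast
    then have "\<forall>P'\<in>hull_of \<Lambda>. agree (max R 1) P P' \<longrightarrow> P' \<in> U"
      using agree_mono[of "max R 1" P _ R] by auto
    then show "\<exists>R>0. \<forall>P'\<in>hull_of \<Lambda>. agree R P P' \<longrightarrow> P' \<in> U"
      by (intro exI[of _ "max R 1"]) auto
  qed blast
  then show ?thesis
    unfolding openin_comb_topology comb_entourage_def restrict_ball_eq_iff by simp
qed

lemma topspace_comb [simp]: "topspace (comb_topology \<Lambda>) = hull_of \<Lambda>"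
proof -
  have "openin (comb_topology \<Lambda>) (hull_of \<Lambda>)" by (simp add: openin_comb)
  moreover have "topspace (comb_topology \<Lambda>) \<subseteq> hull_of \<Lambda>"
    using openin_topspace[of "comb_topology \<Lambda>"] unfolding openin_comb by blast
  ultimately show ?thesis by (metis openin_subset subset_antisym)
qed

lemma openin_comb_cylinder: "openin (comb_topology \<Lambda>) {Q \<in> hull_of \<Lambda>. agree R P Q}"
  unfolding openin_comb using agree_trans by blast

text \<open>Agreement at a fixed radius is an equivalence relation, so the complement of a cylinder
  is a union of cylinders of the same radius.\<close>

lemma closedin_comb_cylinder: "closedin (comb_topology \<Lambda>) {Q \<in> hull_of \<Lambda>. agree R P Q}"
proof -
  have "openin (comb_topology \<Lambda>) (hull_of \<Lambda> - {Q \<in> hull_of \<Lambda>. agree R P Q})"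
    unfolding openin_comb using agree_trans agree_sym by blast
  then show ?thesis by (auto simp: closedin_def)
qed

lemma continuous_translate: "continuous_map (comb_topology \<Lambda>) (comb_topology \<Lambda>) (\<lambda>P. translate P t)"
  unfolding continuous_map_def
proof (intro conjI allI impI)
  show "(\<lambda>P. translate P t) \<in> topspace (comb_topology \<Lambda>) \<rightarrow> topspace (comb_topology \<Lambda>)"
    using translate_hull by auto
  fix U assume U: "openin (comb_topology \<Lambda>) U"
  show "openin (comb_topology \<Lambda>) {P \<in> topspace (comb_topology \<Lambda>). translate P t \<in> U}"
    unfolding openin_comb topspace_comb
  proof (intro conjI ballI)
    fix P assume P: "P \<in> {P \<in> hull_of \<Lambda>. translate P t \<in> U}"
    then obtain R where R: "\<forall>P'\<in>hull_of \<Lambda>. agree R (translate P t) P' \<longrightarrow> P' \<in> U"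
      using U unfolding openin_comb by blast
    have "\<forall>P'\<in>hull_of \<Lambda>. agree (R + norm t) P P' \<longrightarrow> P' \<in> {P \<in> hull_of \<Lambda>. translate P t \<in> U}"
      using R agree_translate[OF _ order_refl] translate_hull[of _ \<Lambda> t] by blast
    then show "\<exists>R. \<forall>P'\<in>hull_of \<Lambda>. agree R P P' \<longrightarrow> P' \<in> {P \<in> hull_of \<Lambda>. translate P t \<in> U}"
      by blast
  qed auto
qed

text \<open>The small shifts permitted by a local entourage are absorbed by the existentially
  quantified \<open>v\<close>.\<close>

lemma openin_local_translates:
  "openin (local_topology \<Lambda>) {Q \<in> hull_of \<Lambda>. \<exists>v. agree R P (translate Q v)}"
  unfolding openin_local_topology
proof (intro conjI ballI)
  fix Q assume "Q \<in> {Q \<in> hull_of \<Lambda>. \<exists>v. agree R P (translate Q v)}"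
  then obtain v where v: "agree R P (translate Q v)" by blast
  \<comment> \<open>Moving the patch by \<open>s + v\<close> costs at most
    \<open>norm v + 1\<close>, since the entourage is taken with \<open>\<epsilon> = 1\<close>;
    \<open>max R 0\<close> keeps the radius positive.\<close>
  let ?R = "max R 0 + norm v + 1"
  have "\<exists>v. agree R P (translate Q' v)"
    if Q': "(Q, Q') \<in> local_entourage ?R 1" for Q'
  proof -
    obtain s s' where s: "norm s \<le> 1" "norm s' \<le> 1"
      "agree ?R (translate Q (- s)) (translate Q' (- s'))"
      using Q' unfolding local_entourage_def restrict_ball_eq_iff by auto
    have "norm (s + v) \<le> norm v + 1" using s(1) norm_triangle_ineq[of s v] by linarith
    then have "R + norm (s + v) \<le> ?R" by linarith
    from agree_translate[OF s(3) this]
    have "agree R (translate Q v) (translate Q' (- s' + (s + v)))" by simp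
    then show ?thesis using agree_trans[OF v] by blast
  qed
  moreover have "?R > 0" using norm_ge_zero[of v] by linarith
  ultimately show "\<exists>R'>0. \<exists>\<epsilon>>0. \<forall>P'\<in>hull_of \<Lambda>. (Q, P') \<in> local_entourage R' \<epsilon> \<longrightarrow>
      P' \<in> {Q \<in> hull_of \<Lambda>. \<exists>v. agree R P (translate Q v)}"
    by (intro exI[of _ ?R] exI[of _ 1] conjI) auto
qed auto

text \<open>Minimality in combinatorial form: every patch of the hull recurs in every pattern,
  exactly and not merely up to a small shift.\<close>

lemma repetitive_translate:
  assumes "repetitive \<Lambda>" "P \<in> hull_of \<Lambda>" "Q \<in> hull_of \<Lambda>"
  obtains v where "agree R P (translate Q v)"
proof -
  define U where "U = {Q \<in> hull_of \<Lambda>. \<exists>v. agree R P (translate Q v)}"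
  have cl: "P \<in> local_topology \<Lambda> closure_of range (\<lambda>t. translate Q (- t))"
    using assms unfolding repetitive_def by blast
  have "P \<in> U"
    using assms(2) agree_refl[of R P] translate_zero[of P] unfolding U_def by (metis (mono_tags) mem_Collect_eq)
  moreover have "openin (local_topology \<Lambda>) U"
    unfolding U_def by (rule openin_local_translates)
  ultimately have "\<exists>y. y \<in> range (\<lambda>t. translate Q (- t)) \<and> y \<in> U"
    using cl unfolding in_closure_of by blast
  then obtain t where "translate Q (- t) \<in> U" by blast
  then obtain v where "agree R P (translate (translate Q (- t)) v)" unfolding U_def by blast
  then show ?thesis using that[of "- t + v"] by simp
qed

section \<open>Difference sets of the support and compactness in the hull\<close>

locale meyer_support =
  fixes \<Lambda> :: "'i::finite \<Rightarrow> 'a::euclidean_space set"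
  assumes meyer: "meyer_set (support \<Lambda>)"
begin

definition D :: "'a set" where
  "D = {x - y |x y. x \<in> support \<Lambda> \<and> y \<in> support \<Lambda>}"

text \<open>Proximal patterns are compared through a point common to their companions
  \<open>P1\<close> and \<open>P2\<close>; both differences with that point lie in \<open>D\<close>,
  so differences of second order arise.\<close>

definition D2 :: "'a set" where
  "D2 = {x - y |x y. x \<in> D \<and> y \<in> D}"

text \<open>A single radius serves the whole hull, because the ball around \<open>x\<close> that
  must contain a point is seen in one patch of \<Lambda>.\<close>

lemma relatively_dense_radius:
  obtains r where "r > 0" "\<And>P x. P \<in> hull_of \<Lambda> \<Longrightarrow> \<exists>y\<in>support P. dist x y \<le> r"
proof -
  obtain r where r: "r > 0" "\<And>x. \<exists>y\<in>support \<Lambda>. dist x y \<le> r"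
    using meyer unfolding meyer_set_def delone_set_def relatively_dense_def by blast
  have "\<exists>y\<in>support P. dist x y \<le> r" if P: "P \<in> hull_of \<Lambda>" for P x
  proof -
    obtain t where t: "agree (norm x + r) P (translate \<Lambda> (- t))" using hull_agree[OF P] by blast
    obtain y where y: "y \<in> support \<Lambda>" "dist (x + t) y \<le> r" using r(2) by blast
    have d: "dist x (y - t) \<le> r" using y(2) by (simp add: dist_norm algebra_simps)
    moreover have "norm (y - t) \<le> norm x + r"
      using d norm_triangle_sub[of "y - t" x] by (simp add: dist_norm norm_minus_commute)
    then have "y - t \<in> support P"
      using agree_support[OF t] y(1) by (simp add: mem_support_translate)
    ultimately show ?thesis by blast
  qed
  then show ?thesis using that r(1) by blast
qed

lemma finite_support_cball: "finite (support \<Lambda> \<inter> cball a r)"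
  using meyer finite_uniform_discrete_cball unfolding meyer_set_def delone_set_def by blast

text \<open>The Meyer inclusion is applied to both elements of \<open>D\<close> and then to the
  difference of their base points, whence the corrections \<open>f + g - h\<close>.\<close>

lemma D2_subset_support:
  obtains F where "finite F" "D2 \<subseteq> {x + f |x f. x \<in> support \<Lambda> \<and> f \<in> F}"
proof -
  obtain F where F: "finite F" "D \<subseteq> {x + f |x f. x \<in> support \<Lambda> \<and> f \<in> F}"
    using meyer unfolding meyer_set_def D_def by blast
  let ?F = "(\<lambda>(f, g, h). f + g - h) ` (F \<times> F \<times> F)"
  have "x \<in> {x + f |x f. x \<in> support \<Lambda> \<and> f \<in> ?F}" if x: "x \<in> D2" for x
  proof -
    obtain a b where ab: "a \<in> D" "b \<in> D" "x = a - b" using x unfolding D2_def by blast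
    obtain s g where s: "s \<in> support \<Lambda>" "g \<in> F" "a = s + g" using F(2) ab(1) by blast
    obtain s' h where s': "s' \<in> support \<Lambda>" "h \<in> F" "b = s' + h" using F(2) ab(2) by blast
    have "s - s' \<in> D" using s s' unfolding D_def by blast
    then obtain z f where z: "z \<in> support \<Lambda>" "f \<in> F" "s - s' = z + f" using F(2) by blast
    have "x = z + (f + g - h)" using ab(3) s(3) s'(3) z(3) by (simp add: algebra_simps)
    moreover have "f + g - h \<in> ?F" using z(2) s(2) s'(2) by (auto simp: image_iff)
    ultimately show ?thesis using z(1) by blast
  qed
  moreover have "finite ?F" using F(1) by simp
  ultimately show ?thesis using that by blast
qed

text \<open>Local finiteness of the support survives a finite union of translates.\<close>

lemma finite_D2_cball: "finite (D2 \<inter> cball a r)"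
proof -
  obtain F where F: "finite F" "D2 \<subseteq> {x + f |x f. x \<in> support \<Lambda> \<and> f \<in> F}"
    by (rule D2_subset_support)
  have "D2 \<inter> cball a r \<subseteq> (\<Union>f\<in>F. (\<lambda>x. x + f) ` (support \<Lambda> \<inter> cball (a - f) r))"
  proof
    fix y assume y: "y \<in> D2 \<inter> cball a r"
    then obtain x f where "x \<in> support \<Lambda>" "f \<in> F" "y = x + f" using F(2) by blast
    moreover have "x \<in> cball (a - f) r"
      using y \<open>y = x + f\<close> by (simp add: dist_norm algebra_simps)
    ultimately show "y \<in> (\<Union>f\<in>F. (\<lambda>x. x + f) ` (support \<Lambda> \<inter> cball (a - f) r))" by blast
  qed
  then show ?thesis
    by (rule finite_subset) (intro finite_UN_I F(1) finite_imageI finite_support_cball)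
qed

lemma support_nonempty: "support \<Lambda> \<noteq> {}"
proof -
  obtain r where "\<And>P x. P \<in> hull_of \<Lambda> \<Longrightarrow> \<exists>y\<in>support P. dist x y \<le> r"
    by (rule relatively_dense_radius) blast
  from this[OF translate_self_hull[of \<Lambda> 0]] show ?thesis by auto
qed

lemma zero_D: "0 \<in> D"
  using support_nonempty unfolding D_def by fastforce

lemma D_subset_D2: "D \<subseteq> D2"
  using zero_D unfolding D2_def by (force intro: exI[of _ 0])

lemma hull_diff_D: "P \<in> hull_of \<Lambda> \<Longrightarrow> x \<in> support P \<Longrightarrow> y \<in> support P \<Longrightarrow> x - y \<in> D"
  unfolding D_def by (blast elim: hull_diff)

text \<open>
  A Koenig argument: patterns through a common point have only finitely many patches of each radius.
\<close>

lemma compactin_comb: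
  assumes closed: "closedin (comb_topology \<Lambda>) C" and x0: "\<And>P. P \<in> C \<Longrightarrow> x0 \<in> support P"
  shows "compactin (comb_topology \<Lambda>) C"
proof (rule ccontr)
  have Ch: "C \<subseteq> hull_of \<Lambda>" using closedin_subset[OF closed] by simp
  assume "\<not> compactin (comb_topology \<Lambda>) C"
  then obtain \<U> where \<U>: "\<And>U. U \<in> \<U> \<Longrightarrow> openin (comb_topology \<Lambda>) U" "C \<subseteq> \<Union>\<U>"
    and no: "\<And>\<F>. finite \<F> \<Longrightarrow> \<F> \<subseteq> \<U> \<Longrightarrow> \<not> C \<subseteq> \<Union>\<F>"
    using Ch unfolding compactin_def topspace_comb by (elim disjE[OF iffD1[OF de_Morgan_conj]]) (simp, metis)
  define bad where "bad A \<longleftrightarrow> A \<subseteq> C \<and> (\<forall>\<F>. finite \<F> \<longrightarrow> \<F> \<subseteq> \<U> \<longrightarrow> \<not> A \<subseteq> \<Union>\<F>)" for A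
  have step: "\<exists>P. P \<in> A \<and> bad {Q \<in> A. agree n P Q}" if A: "bad A" for A n
  proof (rule ccontr)
    assume neg: "\<not> ?thesis"
    let ?r = "\<lambda>P. restrict_ball P n"
    \<comment> \<open>All points of a pattern through \<open>x0\<close> lie in
      \<open>x0 + D\<close>; centring the ball at \<open>- x0\<close> expresses
      \<open>norm x \<le> n\<close> for \<open>x = x0 + d\<close>.\<close>
    let ?E = "(\<lambda>d. x0 + d) ` (D2 \<inter> cball (- x0) n)"
    have AC: "A \<subseteq> C" using A unfolding bad_def by blast
    have "?r ` A \<subseteq> (\<Pi>\<^sub>E i\<in>UNIV. Pow ?E)"
    proof (clarsimp simp: PiE_iff)
      fix P i x assume P: "P \<in> A" and x: "x \<in> restrict_ball P n i"
      then have "x \<in> support P" "norm x \<le> n" unfolding restrict_ball_def support_def by auto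
      moreover have "x0 \<in> support P" "P \<in> hull_of \<Lambda>" using x0 P AC Ch by auto
      ultimately have "x - x0 \<in> D2" "x - x0 \<in> cball (- x0) n"
        using hull_diff_D D_subset_D2 by (blast, simp add: dist_norm)
      then show "x \<in> ?E" by (intro image_eqI[of _ _ "x - x0"]) auto
    qed
    moreover have "finite (\<Pi>\<^sub>E i\<in>(UNIV :: 'i set). Pow ?E)"
      using finite_D2_cball by (intro finite_PiE) auto
    ultimately have "finite (?r ` A)" by (rule finite_subset)
    \<comment> \<open>One representative per patch of radius \<open>n\<close>: the finite covers of
      these finitely many classes combine to a finite cover of \<open>A\<close>.\<close>
    then obtain B where B: "finite B" "B \<subseteq> A" "?r ` A = ?r ` B"
      by (metis finite_subset_image order_refl)
    have "\<forall>P\<in>A. \<exists>\<F>. finite \<F> \<and> \<F> \<subseteq> \<U> \<and> {Q \<in> A. agree n P Q} \<subseteq> \<Union>\<F>"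
    proof
      fix P assume "P \<in> A"
      then have "\<not> bad {Q \<in> A. agree n P Q}" using neg by simp
      moreover have "{Q \<in> A. agree n P Q} \<subseteq> C" using AC by auto
      ultimately show "\<exists>\<F>. finite \<F> \<and> \<F> \<subseteq> \<U> \<and> {Q \<in> A. agree n P Q} \<subseteq> \<Union>\<F>"
        unfolding bad_def by simp
    qed
    from bchoice[OF this]
    obtain G where G: "\<forall>P\<in>A. finite (G P) \<and> G P \<subseteq> \<U> \<and> {Q \<in> A. agree n P Q} \<subseteq> \<Union>(G P)"
      by (rule exE)
    have "A \<subseteq> \<Union>(\<Union>(G ` B))"
    proof
      fix Q assume Q: "Q \<in> A"
      then obtain P where P: "P \<in> B" "?r Q = ?r P" using B(3) by blast
      then have "agree n P Q" using restrict_ball_eq_iff agree_sym by metis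
      moreover have "{Q \<in> A. agree n P Q} \<subseteq> \<Union>(G P)" using G P(1) B(2) by blast
      ultimately have "Q \<in> \<Union>(G P)" using Q by auto
      then show "Q \<in> \<Union>(\<Union>(G ` B))" using P(1) by auto
    qed
    moreover have "finite (\<Union>(G ` B))" "\<Union>(G ` B) \<subseteq> \<U>" using B(1,2) G by auto
    ultimately show False using A unfolding bad_def by simp
  qed
  define pick where "pick n A = (SOME P. P \<in> A \<and> bad {Q \<in> A. agree n P Q})" for n A
  define A where "A = rec_nat C (\<lambda>n A. {Q \<in> A. agree n (pick n A) Q})"
  define p where "p n = pick n (A n)" for n
  have A0: "A 0 = C" and AS: "A (Suc n) = {Q \<in> A n. agree n (p n) Q}" for n
    by (simp_all add: A_def p_def)
  have bad: "bad (A n)" and pA: "p n \<in> A n" for n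
  proof -
    have *: "p n \<in> A n \<and> bad (A (Suc n))" if "bad (A n)" for n
      using someI_ex[OF step[OF that, of n]] unfolding AS p_def pick_def by blast
    show b: "bad (A n)" for n
    proof (induction n)
      case 0 show ?case using no by (auto simp: A0 bad_def)
    qed (use * in blast)
    show "p n \<in> A n" using * b by blast
  qed
  have anti: "A m \<subseteq> A n" if "n \<le> m" for m n
    using that by (rule lift_Suc_antimono_le[rotated]) (auto simp: AS)
  have pp: "agree n (p n) (p m)" if "n \<le> m" for m n
  proof (cases "n = m")
    case False
    then have "p m \<in> A (Suc n)" using pA[of m] anti[of "Suc n" m] that by auto
    then show ?thesis by (simp add: AS)
  qed simp
  \<comment> \<open>The limit pattern: membership of \<open>x\<close> is read off at stage
    \<open>nat \<lceil>norm x\<rceil>\<close>, from which on all \<open>p n\<close> agree at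
    \<open>x\<close>.\<close>
  define P where "P i = {x. x \<in> p (nat \<lceil>norm x\<rceil>) i}" for i
  have Pp: "agree n P (p n)" for n :: nat
    unfolding agree_def
  proof (intro allI impI)
    fix i and x :: 'a assume "norm x \<le> real n"
    then have "nat \<lceil>norm x\<rceil> \<le> n" by (simp add: ceiling_le_iff)
    moreover have "norm x \<le> real (nat \<lceil>norm x\<rceil>)" by linarith
    ultimately have "x \<in> p (nat \<lceil>norm x\<rceil>) i \<longleftrightarrow> x \<in> p n i" using pp agreeD by metis
    then show "x \<in> P i \<longleftrightarrow> x \<in> p n i" by (simp add: P_def)
  qed
  have pC: "p n \<in> C" for n using pA anti[of 0 n] A0 by auto
  have Ph: "P \<in> hull_of \<Lambda>"
  proof (rule hullI)
    fix R
    obtain n where n: "R \<le> real n" using real_arch_simple by blast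
    obtain t where "agree n (p n) (translate \<Lambda> (- t))" using hull_agree pC Ch by blast
    then show "\<exists>t. agree R P (translate \<Lambda> (- t))" using agree_trans[OF Pp] agree_mono n by blast
  qed
  have "P \<in> C"
  proof (rule ccontr)
    assume "P \<notin> C"
    moreover have "openin (comb_topology \<Lambda>) (hull_of \<Lambda> - C)" using closed by (simp add: closedin_def)
    ultimately obtain R where R: "\<forall>Q\<in>hull_of \<Lambda>. agree R P Q \<longrightarrow> Q \<in> hull_of \<Lambda> - C"
      using Ph unfolding openin_comb by blast
    obtain n where n: "R \<le> real n" using real_arch_simple by blast
    then show False using R agree_mono[OF Pp n] pC[of n] Ch by blast
  qed
  then obtain U where U: "U \<in> \<U>" "P \<in> U" using \<U>(2) by blast
  then obtain R where R: "\<forall>Q\<in>hull_of \<Lambda>. agree R P Q \<longrightarrow> Q \<in> U"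
    using \<U>(1) unfolding openin_comb by blast
  obtain n where n: "R \<le> real n" using real_arch_simple by blast
  \<comment> \<open>The index is \<open>Suc n\<close> because agreement with \<open>p n\<close> on
    radius \<open>n\<close> is imposed in passing from \<open>A n\<close> to
    \<open>A (Suc n)\<close>.\<close>
  have "A (Suc n) \<subseteq> U"
  proof
    fix Q assume Q: "Q \<in> A (Suc n)"
    then have "agree n P Q" using agree_trans[OF Pp] by (auto simp: AS)
    moreover have "Q \<in> hull_of \<Lambda>" using Q anti[of 0 "Suc n"] A0 Ch by auto
    ultimately show "Q \<in> U" using R agree_mono n by blast
  qed
  moreover have "finite {U}" "{U} \<subseteq> \<U>" using U by auto
  ultimately show False using bad[of "Suc n"] unfolding bad_def
    by (metis cSup_singleton)
qed

end

section \<open>The quotient by strong regional proximality\<close>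

lemma additive_group_simps [simp]:
  "carrier additive_group = UNIV" "x \<otimes>\<^bsub>additive_group\<^esub> y = x + y" "\<one>\<^bsub>additive_group\<^esub> = 0"
  by (simp_all add: additive_group_def)

lemma comm_group_additive: "comm_group (additive_group :: 'a::ab_group_add monoid)"
proof (rule comm_groupI)
  fix x :: 'a
  show "\<exists>y\<in>carrier additive_group. y \<otimes>\<^bsub>additive_group\<^esub> x = \<one>\<^bsub>additive_group\<^esub>"
    by (intro bexI[of _ "- x"]) simp_all
qed (simp_all add: algebra_simps)

lemma group_additive: "group (additive_group :: 'a::ab_group_add monoid)"
  using comm_group_additive by (rule comm_group.axioms(2))

lemma inv_additive [simp]: "inv\<^bsub>additive_group\<^esub> (x :: 'a::ab_group_add) = - x"
  by (rule group.inv_equality[OF group_additive]) simp_all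

lemma subgroup_additive_iff:
  fixes A :: "'a::ab_group_add set"
  shows "subgroup A additive_group \<longleftrightarrow>
    0 \<in> A \<and> (\<forall>x\<in>A. \<forall>y\<in>A. x + y \<in> A) \<and> (\<forall>x\<in>A. - x \<in> A)"
  by (auto simp: subgroup_def)

lemma hom_additiveD:
  fixes A :: "'a::ab_group_add set"
  assumes "s \<in> hom (additive_group\<lparr>carrier := A\<rparr>) H"
  shows "x \<in> A \<Longrightarrow> s x \<in> carrier H"
    and "x \<in> A \<Longrightarrow> y \<in> A \<Longrightarrow> s (x + y) = s x \<otimes>\<^bsub>H\<^esub> s y"
  using assms by (auto simp: hom_def)

context meyer_support
begin

abbreviation \<Gamma> :: "'a set" where "\<Gamma> \<equiv> support_group \<Lambda>"

lemma subgroup_\<Gamma>: "subgroup \<Gamma> additive_group"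
  unfolding support_group_def by (rule group.generate_is_subgroup[OF group_additive]) simp

lemma zero_\<Gamma> [simp]: "0 \<in> \<Gamma>" and add_\<Gamma>: "x \<in> \<Gamma> \<Longrightarrow> y \<in> \<Gamma> \<Longrightarrow> x + y \<in> \<Gamma>"
  and minus_\<Gamma>: "x \<in> \<Gamma> \<Longrightarrow> - x \<in> \<Gamma>"
  using subgroup_\<Gamma> by (auto simp: subgroup_additive_iff)

lemma diff_\<Gamma>: "x \<in> \<Gamma> \<Longrightarrow> y \<in> \<Gamma> \<Longrightarrow> x - y \<in> \<Gamma>"
  using add_\<Gamma>[OF _ minus_\<Gamma>] by simp

lemma support_\<Gamma>: "x \<in> support \<Lambda> \<Longrightarrow> x \<in> \<Gamma>"
  unfolding support_group_def by (rule generate.incl)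

lemma D_\<Gamma>: "x \<in> D \<Longrightarrow> x \<in> \<Gamma>"
  unfolding D_def using diff_\<Gamma> support_\<Gamma> by blast

lemma countable_\<Gamma>: "countable \<Gamma>"
proof -
  have "support \<Lambda> = (\<Union>n::nat. support \<Lambda> \<inter> cball 0 (real n))"
    using real_arch_simple by fastforce
  moreover have "countable (\<Union>n::nat. support \<Lambda> \<inter> cball 0 (real n))"
    by (intro countable_UN countableI_type countable_finite[OF finite_support_cball])
  ultimately have c: "countable (support \<Lambda>)" by simp
  \<comment> \<open>Every element of the generated group is the sum of a word in the support and its
    negatives.\<close>
  let ?L = "lists (support \<Lambda> \<union> uminus ` support \<Lambda>)"
  have "x \<in> sum_list ` ?L" if "x \<in> generate additive_group (support \<Lambda>)" for x
    using that
  proof induction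
    case one then show ?case by (intro image_eqI[of _ _ "[]"]) auto
  next
    case (incl h) then show ?case by (intro image_eqI[of _ _ "[h]"]) auto
  next
    case (inv h) then show ?case by (intro image_eqI[of _ _ "[- h]"]) auto
  next
    case (eng h1 h2)
    then obtain k l where "k \<in> ?L" "h1 = sum_list k" "l \<in> ?L" "h2 = sum_list l" by blast
    then show ?case by (intro image_eqI[of _ _ "k @ l"]) auto
  qed
  then have "\<Gamma> \<subseteq> sum_list ` ?L" unfolding support_group_def by blast
  moreover have "countable (sum_list ` ?L)" using c by simp
  ultimately show ?thesis by (rule countable_subset)
qed

text \<open>Differences inside a hull pattern lie in \<open>D\<close>, hence in \<Gamma>, so one
  point in \<Gamma> draws all others into it.\<close>

lemma Xi_groupI:
  assumes "P \<in> hull_of \<Lambda>" "x \<in> support P" "x \<in> \<Gamma>"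
  shows "P \<in> Xi_group \<Lambda>"
proof -
  have "y \<in> \<Gamma>" if "y \<in> support P" for y
    using add_\<Gamma>[OF D_\<Gamma>[OF hull_diff_D[OF assms(1) that assms(2)]] assms(3)] by simp
  then show ?thesis using assms(1) unfolding Xi_group_def by blast
qed

lemma Xi_group_hull: "P \<in> Xi_group \<Lambda> \<Longrightarrow> P \<in> hull_of \<Lambda>"
  by (simp add: Xi_group_def)

lemma Xi_group_support: "P \<in> Xi_group \<Lambda> \<Longrightarrow> x \<in> support P \<Longrightarrow> x \<in> \<Gamma>"
  by (auto simp: Xi_group_def)

lemma Xi_group_translate: "P \<in> Xi_group \<Lambda> \<Longrightarrow> \<gamma> \<in> \<Gamma> \<Longrightarrow> translate P \<gamma> \<in> Xi_group \<Lambda>"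
  unfolding Xi_group_def by (auto simp: translate_hull mem_support_translate) (metis add_\<Gamma> diff_add_cancel subsetD)

lemma self_Xi_group: "\<gamma> \<in> \<Gamma> \<Longrightarrow> translate \<Lambda> \<gamma> \<in> Xi_group \<Lambda>"
  using Xi_group_translate[of \<Lambda> \<gamma>] translate_self_hull[of \<Lambda> 0] support_\<Gamma>
  unfolding Xi_group_def by auto

lemma Xi_hull: "P \<in> Xi \<Lambda> i \<Longrightarrow> P \<in> hull_of \<Lambda>" and Xi_mem: "P \<in> Xi \<Lambda> i \<Longrightarrow> 0 \<in> P i"
  and Xi_support: "P \<in> Xi \<Lambda> i \<Longrightarrow> 0 \<in> support P"
  by (auto simp: Xi_def support_def)

lemma Xi_subset: "P \<in> Xi \<Lambda> i \<Longrightarrow> P \<in> Xi_group \<Lambda>"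
  using Xi_groupI[OF Xi_hull Xi_support] by simp

text \<open>Membership of 0 is decided by the patch of radius 0, so \<open>Xi\<close> is closed, and
  0 is the common point that \<open>compactin_comb\<close> asks for.\<close>

lemma compactin_Xi: "compactin (comb_topology \<Lambda>) (Xi \<Lambda> i)"
proof (rule compactin_comb)
  have "openin (comb_topology \<Lambda>) (hull_of \<Lambda> - Xi \<Lambda> i)"
    unfolding openin_comb
  proof (intro conjI ballI)
    fix P assume "P \<in> hull_of \<Lambda> - Xi \<Lambda> i"
    then show "\<exists>R. \<forall>P'\<in>hull_of \<Lambda>. agree R P P' \<longrightarrow> P' \<in> hull_of \<Lambda> - Xi \<Lambda> i"
      by (intro exI[of _ 0]) (auto simp: Xi_def agree_def)
  qed auto
  then show "closedin (comb_topology \<Lambda>) (Xi \<Lambda> i)"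
    by (auto simp: closedin_def Xi_def)
qed (rule Xi_support)

lemma srp_refl: "P \<in> hull_of \<Lambda> \<Longrightarrow> srp \<Lambda> P P"
  unfolding srp_def by blast

lemma srp_class_eqD:
  assumes "srp_class \<Lambda> P = srp_class \<Lambda> Q" "Q \<in> hull_of \<Lambda>"
  shows "srp \<Lambda> P Q"
  using srp_refl[OF assms(2)] assms(1) unfolding srp_class_def by blast

lemma srpD:
  assumes "srp \<Lambda> P Q" "R > 0"
  obtains P1 P2 t where "P1 \<in> hull_of \<Lambda>" "P2 \<in> hull_of \<Lambda>" "agree R P P1" "agree R Q P2"
    "agree R (translate P1 (- t)) (translate P2 (- t))"
  using assms unfolding srp_def restrict_ball_eq_iff by blast

text \<open>With a radius that is at least \<open>r\<close> and reaches \<open>x\<close> and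
  \<open>y\<close>, the patch shared near \<open>t\<close> contains a point \<open>z + t\<close> of
  both companions, and \<open>x\<close> and \<open>y\<close> each differ from it by an element of
  \<open>D\<close>.\<close>

lemma srp_diff_D2:
  assumes "srp \<Lambda> P Q" "x \<in> support P" "y \<in> support Q"
  shows "x - y \<in> D2"
proof -
  obtain r where r: "r > 0" "\<And>P x. P \<in> hull_of \<Lambda> \<Longrightarrow> \<exists>y\<in>support P. dist x y \<le> r"
    using relatively_dense_radius by blast
  define R where "R = max r (max (norm x) (norm y))"
  have R: "R > 0" "norm x \<le> R" "norm y \<le> R" "r \<le> R" using r(1) by (auto simp: R_def)
  obtain P1 P2 t where P: "P1 \<in> hull_of \<Lambda>" "P2 \<in> hull_of \<Lambda>" "agree R P P1" "agree R Q P2"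
    "agree R (translate P1 (- t)) (translate P2 (- t))"
    using srpD[OF assms(1) R(1)] .
  obtain z where z: "z \<in> support (translate P1 (- t))" "dist 0 z \<le> r"
    using r(2)[OF translate_hull[OF P(1)]] by blast
  have "z \<in> support (translate P2 (- t))"
    using agree_support[OF P(5)] z R(4) by auto
  then have zt: "z + t \<in> support P1" "z + t \<in> support P2"
    using z(1) by (auto simp: mem_support_translate)
  have "x \<in> support P1" "y \<in> support P2"
    using agree_support[OF P(3)] agree_support[OF P(4)] R assms by auto
  then have "x - (z + t) \<in> D" "y - (z + t) \<in> D" using hull_diff_D P(1,2) zt by auto
  moreover have "x - y = (x - (z + t)) - (y - (z + t))" by simp
  ultimately show ?thesis unfolding D2_def by blast
qed

abbreviation Xi_top :: "('i \<Rightarrow> 'a set) topology" where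
  "Xi_top \<equiv> subtopology (comb_topology \<Lambda>) (Xi_group \<Lambda>)"

lemma topspace_Xi_top: "topspace Xi_top = Xi_group \<Lambda>"
  by (auto simp: Xi_group_def)

text \<open>The hull supplies only some shift \<open>t\<close>. Enlarging the patch until it
  contains a point \<open>z\<close> gives \<open>z\<close> and \<open>z + t\<close> in \<Gamma>,
  which forces \<open>t\<close> into \<Gamma>.\<close>

lemma dense_orbit: "Xi_top closure_of (translate \<Lambda> ` \<Gamma>) = topspace Xi_top"
  unfolding dense_intersects_open
proof (intro allI impI, elim conjE)
  fix T assume T: "openin Xi_top T" "T \<noteq> {}"
  then obtain U where U: "openin (comb_topology \<Lambda>) U" "T = U \<inter> Xi_group \<Lambda>"
    unfolding openin_subtopology by blast
  then obtain P where P: "P \<in> U" "P \<in> Xi_group \<Lambda>" using T(2) by blast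
  then obtain R where R: "\<forall>Q\<in>hull_of \<Lambda>. agree R P Q \<longrightarrow> Q \<in> U"
    using U(1) unfolding openin_comb by blast
  have Ph: "P \<in> hull_of \<Lambda>" using Xi_group_hull P(2) .
  obtain r where r: "r > 0" "\<And>P x. P \<in> hull_of \<Lambda> \<Longrightarrow> \<exists>y\<in>support P. dist x y \<le> r"
    using relatively_dense_radius by blast
  obtain t where t: "agree (max R r) P (translate \<Lambda> (- t))" using hull_agree[OF Ph] by blast
  obtain z where z: "z \<in> support P" "dist 0 z \<le> r" using r(2)[OF Ph] by blast
  have "norm z \<le> max R r" using z(2) by simp
  then have "z \<in> support (translate \<Lambda> (- t))" using agree_support[OF t] z(1) by blast
  then have "z + t \<in> \<Gamma>" using support_\<Gamma> by (simp add: mem_support_translate)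
  moreover have "z \<in> \<Gamma>" using Xi_group_support[OF P(2) z(1)] .
  ultimately have "- t \<in> \<Gamma>" using diff_\<Gamma>[of z "z + t"] by simp
  moreover have "translate \<Lambda> (- t) \<in> U"
    by (rule R[rule_format, OF translate_self_hull agree_mono[OF t]]) simp
  ultimately show "translate \<Lambda> ` \<Gamma> \<inter> T \<noteq> {}"
    using self_Xi_group U(2) by blast
qed

lemma continuous_translate_Xi_top:
  assumes "\<gamma> \<in> \<Gamma>" shows "continuous_map Xi_top Xi_top (\<lambda>P. translate P \<gamma>)"
proof -
  have "continuous_map Xi_top (comb_topology \<Lambda>) (\<lambda>P. translate P \<gamma>)"
    using continuous_translate by (rule continuous_map_from_subtopology)
  moreover have "(\<lambda>P. translate P \<gamma>) \<in> topspace Xi_top \<rightarrow> Xi_group \<Lambda>"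
    unfolding topspace_Xi_top using Xi_group_translate assms by blast
  ultimately show ?thesis unfolding continuous_map_in_subtopology by blast
qed

end

locale srp_cps = meyer_support \<Lambda> + lca H "srp_topology \<Lambda>"
  for \<Lambda> :: "'i::finite \<Rightarrow> 'a::euclidean_space set" and H :: "('i \<Rightarrow> 'a set) set monoid" (structure) +
  assumes repetitive: "repetitive \<Lambda>" and srp_group: "srp_group \<Lambda> H"
begin

abbreviation s :: "'a \<Rightarrow> ('i \<Rightarrow> 'a set) set" where "s \<equiv> srp_map \<Lambda>"
abbreviation cls :: "('i \<Rightarrow> 'a set) \<Rightarrow> ('i \<Rightarrow> 'a set) set" where "cls \<equiv> srp_class \<Lambda>"

lemma carrier_H: "carrier H = cls ` Xi_group \<Lambda>"
  using srp_group by (simp add: srp_group_def)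

lemma cls_closed: "P \<in> Xi_group \<Lambda> \<Longrightarrow> cls P \<in> carrier H"
  by (simp add: carrier_H)

lemma s_hom: "s \<in> hom (additive_group\<lparr>carrier := \<Gamma>\<rparr>) H"
  using srp_group by (simp add: srp_group_def)

lemmas s_closed = hom_additiveD(1)[OF s_hom] and s_add = hom_additiveD(2)[OF s_hom]

lemma s_zero: "s 0 = \<one>"
  using s_add[of 0 0] s_closed[of 0] by (simp add: r_cancel_one')

lemma s_minus: "\<gamma> \<in> \<Gamma> \<Longrightarrow> s (- \<gamma>) = inv (s \<gamma>)"
  using s_add[of "- \<gamma>" \<gamma>] s_zero s_closed minus_\<Gamma> by (intro inv_equality[symmetric]) auto

lemma s_cls: "s \<gamma> = cls (translate \<Lambda> \<gamma>)"
  by (simp add: srp_map_def)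

lemma quotient_cls: "quotient_map Xi_top (srp_topology \<Lambda>) cls"
  unfolding srp_topology_def by (rule quotient_map_quotient_topology)

lemmas continuous_cls = quotient_imp_continuous_map[OF quotient_cls]

text \<open>On the orbit of \<Lambda> this is the morphism property of \<open>s\<close>; both sides
  are continuous in \<open>P\<close> with values in a Hausdorff space, so density of the orbit gives
  the rest.\<close>

lemma cls_translate:
  assumes "P \<in> Xi_group \<Lambda>" "\<gamma> \<in> \<Gamma>"
  shows "cls (translate P \<gamma>) = s \<gamma> \<otimes> cls P"
proof (rule forall_in_closure_of_eq[where X = Xi_top and S = "translate \<Lambda> ` \<Gamma>"])
  show "P \<in> Xi_top closure_of (translate \<Lambda> ` \<Gamma>)"
    using assms(1) unfolding dense_orbit topspace_Xi_top .
  show "Hausdorff_space (srp_topology \<Lambda>)" by (rule hausdorff)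
  show "continuous_map Xi_top (srp_topology \<Lambda>) (\<lambda>P. cls (translate P \<gamma>))"
    using continuous_map_compose[OF continuous_translate_Xi_top[OF assms(2)] continuous_cls]
    by (simp add: o_def)
  show "continuous_map Xi_top (srp_topology \<Lambda>) (\<lambda>P. s \<gamma> \<otimes> cls P)"
    using s_closed[OF assms(2)] by (intro continuous_mult continuous_cls) simp
  show "cls (translate Q \<gamma>) = s \<gamma> \<otimes> cls Q" if "Q \<in> translate \<Lambda> ` \<Gamma>" for Q
    using that s_add[OF assms(2)] by (auto simp: s_cls add.commute)
qed

lemma dense_range: "srp_topology \<Lambda> closure_of (s ` \<Gamma>) = topspace (srp_topology \<Lambda>)"
proof
  have "carrier H = cls ` (Xi_top closure_of (translate \<Lambda> ` \<Gamma>))"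
    unfolding dense_orbit topspace_Xi_top carrier_H ..
  also have "\<dots> \<subseteq> srp_topology \<Lambda> closure_of (cls ` translate \<Lambda> ` \<Gamma>)"
    by (rule continuous_map_image_closure_subset[OF continuous_cls])
  also have "cls ` translate \<Lambda> ` \<Gamma> = s ` \<Gamma>" by (auto simp: s_cls)
  finally show "topspace (srp_topology \<Lambda>) \<subseteq> srp_topology \<Lambda> closure_of (s ` \<Gamma>)" by simp
qed (rule closure_of_subset_topspace)

lemma compactin_cls:
  assumes "compactin (comb_topology \<Lambda>) C" "C \<subseteq> Xi_group \<Lambda>"
  shows "compactin (srp_topology \<Lambda>) (cls ` C)"
  using assms by (intro image_compactin[OF _ continuous_cls]) (simp add: compactin_subtopology)

text \<open>
  By repetitivity, countably many translates of the image of a cylinder cover the group, so Baire's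
  theorem applies.
\<close>

lemma cylinder_interior:
  assumes "P \<in> Xi_group \<Lambda>" "x \<in> support P" "norm x \<le> R"
  shows "srp_topology \<Lambda> interior_of (cls ` {Q \<in> hull_of \<Lambda>. agree R P Q}) \<noteq> {}"
proof -
  let ?C = "{Q \<in> hull_of \<Lambda>. agree R P Q}"
  have xC: "x \<in> support Q" if "Q \<in> ?C" for Q
    using agree_support[of R P Q x] that assms by blast
  have x\<Gamma>: "x \<in> \<Gamma>" using Xi_group_support assms by blast
  have CX: "?C \<subseteq> Xi_group \<Lambda>" using Xi_groupI[OF _ xC x\<Gamma>] by blast
  have comp: "compactin (srp_topology \<Lambda>) (cls ` ?C)"
    by (intro compactin_cls CX compactin_comb[OF closedin_comb_cylinder xC])
  let ?G = "(\<lambda>\<gamma>. (\<lambda>h. s \<gamma> \<otimes> h) ` (cls ` ?C)) ` \<Gamma>"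
  have cover: "carrier H \<subseteq> \<Union>?G"
  proof
    fix h assume "h \<in> carrier H"
    then obtain Q where Q: "Q \<in> Xi_group \<Lambda>" "h = cls Q" unfolding carrier_H by blast
    obtain v where v: "agree R P (translate Q v)"
      using repetitive_translate[OF repetitive Xi_group_hull Xi_group_hull] assms(1) Q(1) by blast
    then have C: "translate Q v \<in> ?C" using translate_hull Xi_group_hull[OF Q(1)] by blast
    \<comment> \<open>The point \<open>x\<close> of the cylinder comes from the point
      \<open>x - v\<close> of \<open>Q\<close>; both lie in \<Gamma>, so the shift found by
      repetitivity lies in this countable group.\<close>
    have "x - v \<in> \<Gamma>" using xC[OF C] Xi_group_support[OF Q(1)] by (simp add: mem_support_translate)
    then have v\<Gamma>: "v \<in> \<Gamma>" using diff_\<Gamma>[OF x\<Gamma>, of "x - v"] by simp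
    have "s (- v) \<otimes> cls (translate Q v) = cls (translate (translate Q v) (- v))"
      using cls_translate[OF Xi_group_translate[OF Q(1) v\<Gamma>] minus_\<Gamma>[OF v\<Gamma>]] by simp
    then have "h = s (- v) \<otimes> cls (translate Q v)" using Q(2) by simp
    then show "h \<in> \<Union>?G" using C minus_\<Gamma>[OF v\<Gamma>] by blast
  qed
  obtain K where K: "K \<in> ?G" "srp_topology \<Lambda> interior_of K \<noteq> {}"
  proof (rule Baire_cover[of ?G "carrier H"])
    show "countable ?G" using countable_\<Gamma> by simp
    show "closedin (srp_topology \<Lambda>) C" if "C \<in> ?G" for C
      using that comp s_closed by (auto intro!: compactin_closedin compactin_image_mult)
    show "openin (srp_topology \<Lambda>) (carrier H)" using openin_topspace[of "srp_topology \<Lambda>"] by simp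
    show "carrier H \<noteq> {}" by auto
  qed (use cover in blast)+
  then obtain \<gamma> where \<gamma>: "\<gamma> \<in> \<Gamma>" "K = (\<lambda>h. s \<gamma> \<otimes> h) ` (cls ` ?C)" by blast
  let ?O = "srp_topology \<Lambda> interior_of K"
  \<comment> \<open>Translating the interior back by \<open>inv (s \<gamma>)\<close> places it in
    the image of the original cylinder.\<close>
  let ?U = "{h \<in> carrier H. s \<gamma> \<otimes> h \<in> ?O}"
  have sc: "s \<gamma> \<in> carrier H" using s_closed \<gamma>(1) .
  have "openin (srp_topology \<Lambda>) ?U"
    by (rule openin_preimage_mult) (use sc in auto)
  moreover have "?U \<subseteq> cls ` ?C"
  proof
    fix h assume h: "h \<in> ?U"
    then have "s \<gamma> \<otimes> h \<in> K"
      using subsetD[OF interior_of_subset[of "srp_topology \<Lambda>" K]] by simp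
    then obtain Q where Q: "Q \<in> ?C" "s \<gamma> \<otimes> h = s \<gamma> \<otimes> cls Q" using \<gamma>(2) by auto
    moreover have "cls Q \<in> carrier H" using cls_closed[OF subsetD[OF CX Q(1)]] .
    ultimately have "h = cls Q" using h sc by simp
    then show "h \<in> cls ` ?C" using Q(1) by blast
  qed
  ultimately have sub: "?U \<subseteq> srp_topology \<Lambda> interior_of (cls ` ?C)"
    by (rule interior_of_maximal[rotated])
  obtain k where k: "k \<in> ?O" using K(2) by blast
  have kc: "k \<in> carrier H" using k interior_of_subset_topspace by fastforce
  have "inv (s \<gamma>) \<otimes> k \<in> ?U" using k kc sc by (simp add: m_assoc[symmetric])
  then show ?thesis using sub by blast
qed

lemma srp_window_eq: "srp_window \<Lambda> H i = (\<lambda>h. inv h) ` (cls ` Xi \<Lambda> i)"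
  by (auto simp: srp_window_def)

text \<open>For regularity, a neighbourhood of \<open>inv (cls P)\<close> contains the inverted
  image of a small cylinder around \<open>P\<close>, which also lies in the window;
  \<open>cylinder_interior\<close> supplies an interior point of that image.\<close>

lemma window_srp: "window (srp_topology \<Lambda>) (srp_window \<Lambda> H)"
  unfolding window_def
proof
  fix i
  let ?W = "srp_window \<Lambda> H i"
  have comp: "compactin (srp_topology \<Lambda>) ?W"
    unfolding srp_window_eq
    by (intro compactin_image_inv compactin_cls compactin_Xi) (use Xi_subset in blast)
  have "w \<in> srp_topology \<Lambda> closure_of (srp_topology \<Lambda> interior_of ?W)" if w: "w \<in> ?W" for w
    unfolding in_closure_of
  proof (intro conjI allI impI, goal_cases)
    case 1
    show ?case using w compactin_subset_topspace[OF comp] by blast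
  next
    case (2 U)
    then have U: "openin (srp_topology \<Lambda>) U" "w \<in> U" by auto
    obtain P where P: "P \<in> Xi \<Lambda> i" "w = inv (cls P)" using w by (auto simp: srp_window_def)
    define V where "V = {x \<in> carrier H. inv x \<in> U}"
    have "openin (srp_topology \<Lambda>) V" unfolding V_def by (rule openin_preimage_inv[OF U(1)])
    then have "openin Xi_top {Q \<in> topspace Xi_top. cls Q \<in> V}"
      by (rule openin_continuous_map_preimage[OF continuous_cls])
    then obtain U' where U': "openin (comb_topology \<Lambda>) U'"
      "{Q \<in> topspace Xi_top. cls Q \<in> V} = U' \<inter> Xi_group \<Lambda>"
      unfolding openin_subtopology by blast
    have "P \<in> {Q \<in> topspace Xi_top. cls Q \<in> V}"
      using P U(2) Xi_subset cls_closed unfolding topspace_Xi_top V_def by auto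
    then obtain R where R: "\<forall>Q\<in>hull_of \<Lambda>. agree R P Q \<longrightarrow> Q \<in> U'"
      using U' unfolding openin_comb by blast
    \<comment> \<open>Radius at least \<open>R\<close> keeps the classes in \<open>V\<close>; radius
      at least 0 preserves the point 0 and with it membership in \<open>Xi\<close>.\<close>
    let ?C = "{Q \<in> hull_of \<Lambda>. agree (max R 0) P Q}"
    have CXi: "Q \<in> Xi \<Lambda> i" if "Q \<in> ?C" for Q
      using that agreeD[of "max R 0" P Q 0 i] Xi_mem[OF P(1)] by (auto simp: Xi_def)
    have CV: "cls Q \<in> V" if "Q \<in> ?C" for Q
    proof -
      have "Q \<in> U'" using R that agree_mono[of "max R 0" P Q R] by auto
      then have "Q \<in> U' \<inter> Xi_group \<Lambda>" using Xi_subset CXi[OF that] by blast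
      then show ?thesis using U'(2) by blast
    qed
    define O' where "O' = srp_topology \<Lambda> interior_of (cls ` ?C)"
    have "O' \<noteq> {}"
      unfolding O'_def by (rule cylinder_interior[OF Xi_subset[OF P(1)] Xi_support[OF P(1)]]) simp
    then obtain k where k: "k \<in> O'" by blast
    have OC: "O' \<subseteq> cls ` ?C" unfolding O'_def by (rule interior_of_subset)
    have kc: "k \<in> carrier H" using k unfolding O'_def using interior_of_subset_topspace by fastforce
    have "openin (srp_topology \<Lambda>) {x \<in> carrier H. inv x \<in> O'}"
      unfolding O'_def by (rule openin_preimage_inv) simp
    moreover have "{x \<in> carrier H. inv x \<in> O'} \<subseteq> ?W"
    proof
      fix x assume x: "x \<in> {x \<in> carrier H. inv x \<in> O'}"
      then obtain Q where "Q \<in> ?C" "inv x = cls Q" using OC by blast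
      then show "x \<in> ?W" unfolding srp_window_eq using CXi x
        by (metis (no_types, lifting) imageI inv_inv mem_Collect_eq)
    qed
    ultimately have "{x \<in> carrier H. inv x \<in> O'} \<subseteq> srp_topology \<Lambda> interior_of ?W"
      by (rule interior_of_maximal[rotated])
    then have "inv k \<in> srp_topology \<Lambda> interior_of ?W" using k kc by auto
    moreover have "inv k \<in> U" using k OC CV unfolding V_def by blast
    ultimately show ?case by blast
  qed
  moreover have "srp_topology \<Lambda> closure_of (srp_topology \<Lambda> interior_of ?W) \<subseteq> ?W"
    by (rule closure_of_minimal[OF interior_of_subset compactin_closedin[OF comp]])
  ultimately show "compactin (srp_topology \<Lambda>) ?W \<and>
      srp_topology \<Lambda> closure_of (srp_topology \<Lambda> interior_of ?W) = ?W"
    using comp by blast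
qed

text \<open>This is what the inverse in \<open>srp_window\<close> is for: \<Lambda> shifted by
  \<open>- x\<close> has a point at 0, and its class is \<open>s (- x)\<close>.\<close>

lemma s_window:
  assumes "x \<in> \<Lambda> i" shows "x \<in> \<Gamma>" "s x \<in> srp_window \<Lambda> H i"
proof -
  show x: "x \<in> \<Gamma>" using assms support_\<Gamma> by (auto simp: support_def)
  have "translate \<Lambda> (- x) \<in> Xi \<Lambda> i"
    using assms translate_self_hull by (simp add: Xi_def mem_translate)
  moreover have "s x = inv (s (- x))" using s_minus[OF x] s_closed[OF x] by simp
  ultimately show "s x \<in> srp_window \<Lambda> H i" by (auto simp: srp_window_def s_cls)
qed

end

section \<open>Cut and project schemes\<close>

locale cps = lca H T for H :: "'h monoid" (structure) and T :: "'h topology" +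
  fixes \<Gamma> :: "'a::euclidean_space set" and s :: "'a \<Rightarrow> 'h"
  assumes cps: "cut_project_scheme H T \<Gamma> s"
begin

lemma s_hom: "s \<in> hom (additive_group\<lparr>carrier := \<Gamma>\<rparr>) H"
  using cps by (simp add: cut_project_scheme_def)

lemmas s_closed = hom_additiveD(1)[OF s_hom] and s_add = hom_additiveD(2)[OF s_hom]

lemma subgroup_\<Gamma>: "subgroup \<Gamma> additive_group"
  using cps by (simp add: cut_project_scheme_def)

lemma zero_\<Gamma> [simp]: "0 \<in> \<Gamma>" and add_\<Gamma>: "x \<in> \<Gamma> \<Longrightarrow> y \<in> \<Gamma> \<Longrightarrow> x + y \<in> \<Gamma>"
  and minus_\<Gamma>: "x \<in> \<Gamma> \<Longrightarrow> - x \<in> \<Gamma>"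
  using subgroup_\<Gamma> by (auto simp: subgroup_additive_iff)

lemma diff_\<Gamma>: "x \<in> \<Gamma> \<Longrightarrow> y \<in> \<Gamma> \<Longrightarrow> x - y \<in> \<Gamma>"
  using add_\<Gamma>[OF _ minus_\<Gamma>] by simp

lemma s_zero: "s 0 = \<one>"
  using s_add[of 0 0] s_closed[of 0] by (simp add: r_cancel_one')

lemma s_minus: "\<gamma> \<in> \<Gamma> \<Longrightarrow> s (- \<gamma>) = inv (s \<gamma>)"
  using s_add[of "- \<gamma>" \<gamma>] s_zero s_closed minus_\<Gamma> by (intro inv_equality[symmetric]) auto

lemma s_diff: "\<gamma> \<in> \<Gamma> \<Longrightarrow> \<delta> \<in> \<Gamma> \<Longrightarrow> s (\<gamma> - \<delta>) = inv (s \<delta>) \<otimes> s \<gamma>"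
  using s_add[of \<gamma> "- \<delta>"] s_minus[of \<delta>] minus_\<Gamma>[of \<delta>] s_closed by (simp add: m_comm)

lemma dense_range: "T closure_of (s ` \<Gamma>) = topspace T"
  using cps by (simp add: cut_project_scheme_def)

lemma graph_isolated_zero:
  obtains U e where "openin T U" "\<one> \<in> U" "e > 0"
    "\<And>\<gamma>. \<gamma> \<in> \<Gamma> \<Longrightarrow> s \<gamma> \<in> U \<Longrightarrow> norm \<gamma> < e \<Longrightarrow> \<gamma> = 0"
proof -
  let ?L = "(\<lambda>\<gamma>. (s \<gamma>, \<gamma>)) ` \<Gamma>"
  have "subtopology (prod_topology T euclidean) ?L = discrete_topology ?L"
    using cps by (simp add: cut_project_scheme_def lattice_in_def)
  moreover have L0: "(\<one>, 0) \<in> ?L" using s_zero by force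
  ultimately have "openin (subtopology (prod_topology T euclidean) ?L) {(\<one>, 0)}" by simp
  then obtain Q where Q: "openin (prod_topology T euclidean) Q" "{(\<one>, 0)} = Q \<inter> ?L"
    unfolding openin_subtopology by blast
  from Q(2) have "(\<one>, 0) \<in> Q" by blast
  from Q(1)[unfolded openin_prod_topology_alt, rule_format, OF this]
  obtain U V where UV: "openin T U" "openin euclidean V" "\<one> \<in> U" "0 \<in> V" "U \<times> V \<subseteq> Q"
    by (elim exE conjE)
  then obtain e where e: "e > 0" "ball 0 e \<subseteq> V"
    by (metis open_contains_ball open_openin)
  have "\<gamma> = 0" if "\<gamma> \<in> \<Gamma>" "s \<gamma> \<in> U" "norm \<gamma> < e" for \<gamma>
  proof -
    have "(s \<gamma>, \<gamma>) \<in> Q" using UV(5) e(2) that by auto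
    then have "(s \<gamma>, \<gamma>) \<in> {(\<one>, 0)}" using Q(2) that(1) by blast
    then show ?thesis by simp
  qed
  then show ?thesis using that UV e(1) by blast
qed

text \<open>Two graph points in the same small box differ by a graph point near zero, so they coincide.\<close>

lemma finite_cut_project_cball:
  assumes "compactin T C"
  shows "finite {\<gamma> \<in> \<Gamma>. s \<gamma> \<in> C \<and> norm \<gamma> \<le> r}"
proof -
  obtain U e where U: "openin T U" "\<one> \<in> U" and e: "e > 0"
    and iso: "\<And>\<gamma>. \<gamma> \<in> \<Gamma> \<Longrightarrow> s \<gamma> \<in> U \<Longrightarrow> norm \<gamma> < e \<Longrightarrow> \<gamma> = 0"
    using graph_isolated_zero by blast
  obtain M where M: "openin T M" "\<one> \<in> M" "\<And>x y. x \<in> M \<Longrightarrow> y \<in> M \<Longrightarrow> inv x \<otimes> y \<in> U"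
    using nhd_diff[OF U] by metis
  have "T closure_of carrier H = topspace T"
    using closure_of_topspace[of T] by simp
  from compact_cover_nhd[OF assms M(1,2) this]
  obtain F where F: "finite F" "F \<subseteq> carrier H" "\<And>c. c \<in> C \<Longrightarrow> \<exists>f\<in>F. inv f \<otimes> c \<in> M"
    by blast
  have "compact (cball (0::'a) r)" by simp
  moreover have "e / 2 > 0" using e by simp
  ultimately have "\<exists>B. finite B \<and> cball (0::'a) r \<subseteq> (\<Union>b\<in>B. ball b (e / 2))"
    unfolding compact_eq_totally_bounded by (elim conjE allE impE)
  then obtain B where B: "finite B" "cball (0::'a) r \<subseteq> (\<Union>b\<in>B. ball b (e / 2))"
    by (elim exE conjE)
  let ?S = "{\<gamma> \<in> \<Gamma>. s \<gamma> \<in> C \<and> norm \<gamma> \<le> r}"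
  have "\<forall>\<gamma>\<in>?S. \<exists>p. p \<in> F \<times> B \<and> inv (fst p) \<otimes> s \<gamma> \<in> M \<and> dist (snd p) \<gamma> < e / 2"
  proof
    fix \<gamma> assume \<gamma>: "\<gamma> \<in> ?S"
    obtain f where "f \<in> F" "inv f \<otimes> s \<gamma> \<in> M" using F(3) \<gamma> by blast
    moreover have "\<gamma> \<in> cball 0 r" using \<gamma> by simp
    then obtain b where "b \<in> B" "dist b \<gamma> < e / 2" using B(2) by auto
    ultimately show "\<exists>p. p \<in> F \<times> B \<and> inv (fst p) \<otimes> s \<gamma> \<in> M \<and> dist (snd p) \<gamma> < e / 2"
      by (intro exI[of _ "(f, b)"]) auto
  qed
  from bchoice[OF this] obtain h where
    h: "\<forall>\<gamma>\<in>?S. h \<gamma> \<in> F \<times> B \<and> inv (fst (h \<gamma>)) \<otimes> s \<gamma> \<in> M \<and> dist (snd (h \<gamma>)) \<gamma> < e / 2"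
    by (rule exE)
  have "inj_on h ?S"
  proof (rule inj_onI)
    fix \<gamma> \<delta> assume \<gamma>\<delta>: "\<gamma> \<in> ?S" "\<delta> \<in> ?S" "h \<gamma> = h \<delta>"
    define f where "f = fst (h \<gamma>)"
    have f: "f \<in> carrier H" using h \<gamma>\<delta>(1) F(2) unfolding f_def by (metis mem_Times_iff subsetD)
    have c: "s \<gamma> \<in> carrier H" "s \<delta> \<in> carrier H" using s_closed \<gamma>\<delta> by auto
    have "inv f \<otimes> s \<gamma> \<in> M" "inv f \<otimes> s \<delta> \<in> M"
      using bspec[OF h \<gamma>\<delta>(1)] bspec[OF h \<gamma>\<delta>(2)] \<gamma>\<delta>(3) unfolding f_def by simp_all
    then have "inv (inv f \<otimes> s \<gamma>) \<otimes> (inv f \<otimes> s \<delta>) \<in> U" by (rule M(3))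
    also have "inv (inv f \<otimes> s \<gamma>) \<otimes> (inv f \<otimes> s \<delta>) = inv (s \<gamma>) \<otimes> s \<delta>"
    proof -
      have "f \<otimes> (inv f \<otimes> s \<delta>) = s \<delta>" using f c by (simp add: m_assoc[symmetric])
      then show ?thesis using f c by (simp add: inv_mult_group m_assoc)
    qed
    also have "\<dots> = s (\<delta> - \<gamma>)" using s_diff \<gamma>\<delta> by simp
    finally have sU: "s (\<delta> - \<gamma>) \<in> U" .
    have "dist (snd (h \<gamma>)) \<gamma> < e / 2" "dist (snd (h \<gamma>)) \<delta> < e / 2"
      using bspec[OF h \<gamma>\<delta>(1)] bspec[OF h \<gamma>\<delta>(2)] \<gamma>\<delta>(3) by simp_all
    then have "dist \<delta> \<gamma> < e" using dist_triangle_half_r by blast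
    then have "\<delta> - \<gamma> = 0" using iso[OF _ sU] diff_\<Gamma> \<gamma>\<delta> by (simp add: dist_norm)
    then show "\<gamma> = \<delta>" by simp
  qed
  moreover have "h ` ?S \<subseteq> F \<times> B" using h by blast
  moreover have "finite (F \<times> B)" using F(1) B(1) by simp
  ultimately show ?thesis by (rule inj_on_finite)
qed

end

text \<open>The image of a cylinder has interior, which contains some \<open>s \<gamma>0\<close> by
  density. For \<open>s \<delta>\<close> near the identity, proximality to a pattern through 0 puts
  \<open>x0 + \<gamma>0 + \<delta>\<close> into \<open>D2\<close>. So only finitely many short
  \<delta> occur, and the images of those with \<open>s \<delta> \<noteq> \<one>\<close> are removed
  from the neighbourhood.\<close>

lemma (in srp_cps) s_isolated_zero:
  obtains N r where "openin (srp_topology \<Lambda>) N" "\<one> \<in> N" "r > 0"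
    "\<And>\<delta>. \<delta> \<in> \<Gamma> \<Longrightarrow> s \<delta> \<in> N \<Longrightarrow> norm \<delta> < r \<Longrightarrow> \<delta> = 0"
proof -
  obtain x0 where x0: "x0 \<in> support \<Lambda>" using support_nonempty by blast
  define P where "P = translate \<Lambda> (- x0)"
  have P: "P \<in> Xi_group \<Lambda>" "0 \<in> support P"
    unfolding P_def using self_Xi_group[OF minus_\<Gamma>[OF support_\<Gamma>[OF x0]]] x0
    by (auto simp: mem_support_translate)
  let ?C = "{Q \<in> hull_of \<Lambda>. agree 0 P Q}"
  define O' where "O' = srp_topology \<Lambda> interior_of (cls ` ?C)"
  have O': "openin (srp_topology \<Lambda>) O'" "O' \<noteq> {}" "O' \<subseteq> cls ` ?C"
    unfolding O'_def using cylinder_interior[OF P] by (simp_all add: interior_of_subset)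
  then obtain \<gamma>0 where \<gamma>0: "\<gamma>0 \<in> \<Gamma>" "s \<gamma>0 \<in> O'"
    using dense_range unfolding dense_intersects_open by blast
  have sc: "s \<gamma>0 \<in> carrier H" using s_closed \<gamma>0(1) .
  define N1 where "N1 = {h \<in> carrier H. s \<gamma>0 \<otimes> h \<in> O'}"
  have N1: "openin (srp_topology \<Lambda>) N1"
    unfolding N1_def by (rule openin_preimage_mult[OF O'(1) sc])
  have N1D2: "x0 + \<gamma>0 + \<delta> \<in> D2" if "\<delta> \<in> \<Gamma>" "s \<delta> \<in> N1" for \<delta>
  proof -
    have "s (\<gamma>0 + \<delta>) \<in> O'" using that \<gamma>0 s_add unfolding N1_def by simp
    then obtain Q where Q: "Q \<in> ?C" "s (\<gamma>0 + \<delta>) = cls Q" using O'(3) by blast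
    have "srp \<Lambda> (translate \<Lambda> (\<gamma>0 + \<delta>)) Q"
      using Q by (intro srp_class_eqD) (auto simp: s_cls)
    moreover have "x0 + (\<gamma>0 + \<delta>) \<in> support (translate \<Lambda> (\<gamma>0 + \<delta>))"
      using x0 by (simp add: mem_support_translate)
    moreover have "0 \<in> support Q" using Q(1) P(2) agree_support[of 0 P Q 0] by simp
    ultimately have "x0 + (\<gamma>0 + \<delta>) - 0 \<in> D2" by (rule srp_diff_D2)
    then show ?thesis by (simp add: add.assoc)
  qed
  define \<Phi> where "\<Phi> = {\<delta>. norm \<delta> \<le> 1 \<and> x0 + \<gamma>0 + \<delta> \<in> D2}"
  have "\<Phi> \<subseteq> (\<lambda>x. x - (x0 + \<gamma>0)) ` (D2 \<inter> cball (x0 + \<gamma>0) 1)"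
  proof
    fix \<delta> assume "\<delta> \<in> \<Phi>"
    then show "\<delta> \<in> (\<lambda>x. x - (x0 + \<gamma>0)) ` (D2 \<inter> cball (x0 + \<gamma>0) 1)"
      by (intro image_eqI[of _ _ "x0 + \<gamma>0 + \<delta>"]) (auto simp: \<Phi>_def dist_norm)
  qed
  then have fin: "finite \<Phi>" using finite_D2_cball by (meson finite_imageI finite_subset)
  define N where "N = N1 - s ` {\<delta> \<in> \<Phi> \<inter> \<Gamma>. s \<delta> \<noteq> \<one>}"
  have "closedin (srp_topology \<Lambda>) (s ` {\<delta> \<in> \<Phi> \<inter> \<Gamma>. s \<delta> \<noteq> \<one>})"
    using fin s_closed by (intro closedin_Hausdorff_finite[OF hausdorff]) auto
  then have N: "openin (srp_topology \<Lambda>) N" unfolding N_def using N1 by (intro openin_diff)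
  have N1': "\<one> \<in> N" unfolding N_def N1_def using \<gamma>0 sc by auto
  \<comment> \<open>What remains is the kernel of \<open>s\<close>: proximality of \<Lambda> +
    \<delta> and \<Lambda> forces \<delta> into \<open>D2\<close>, whose non-zero elements in the
    unit ball have norm at least \<open>d\<close>.\<close>
  obtain d where d: "d > 0" "\<forall>x\<in>D2 \<inter> cball 0 1. x \<noteq> 0 \<longrightarrow> d \<le> dist 0 x"
    using finite_set_avoid[OF finite_D2_cball] by blast
  show ?thesis
  proof (rule that[OF N N1', of "min d 1"])
    show "min d 1 > 0" using d(1) by simp
    fix \<delta> assume \<delta>: "\<delta> \<in> \<Gamma>" "s \<delta> \<in> N" "norm \<delta> < min d 1"
    have "\<delta> \<in> \<Phi>" using N1D2 \<delta> unfolding \<Phi>_def N_def by simp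
    then have "s \<delta> = \<one>" using \<delta> unfolding N_def by blast
    then have "cls (translate \<Lambda> \<delta>) = cls (translate \<Lambda> 0)" using s_zero by (simp add: s_cls)
    then have "srp \<Lambda> (translate \<Lambda> \<delta>) (translate \<Lambda> 0)"
      by (rule srp_class_eqD) (rule translate_self_hull)
    moreover have "x0 + \<delta> \<in> support (translate \<Lambda> \<delta>)" using x0 by (simp add: mem_support_translate)
    moreover have "x0 \<in> support (translate \<Lambda> 0)" using x0 by simp
    ultimately have "x0 + \<delta> - x0 \<in> D2" by (rule srp_diff_D2)
    then show "\<delta> = 0" using d(2) \<delta>(3) by fastforce
  qed
qed

lemma (in srp_cps) cut_project_scheme_srp: "cut_project_scheme H (srp_topology \<Lambda>) \<Gamma> s"
proof -
  let ?T = "srp_topology \<Lambda>"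
  let ?PT = "prod_topology ?T (euclidean :: 'a topology)"
  let ?G = "H \<times>\<times> (additive_group :: 'a monoid)"
  let ?L = "(\<lambda>\<gamma>. (s \<gamma>, \<gamma>)) ` \<Gamma>"
  interpret G: group ?G
    using DirProd_group[OF is_group group_additive] .
  have sub: "subgroup ?L ?G"
  proof (rule G.subgroupI)
    show "?L \<subseteq> carrier ?G" using s_closed by auto
    show "?L \<noteq> {}" using zero_\<Gamma> by blast
    fix a assume "a \<in> ?L"
    then obtain \<gamma> where \<gamma>: "\<gamma> \<in> \<Gamma>" "a = (s \<gamma>, \<gamma>)" by blast
    then have "inv\<^bsub>?G\<^esub> a = (s (- \<gamma>), - \<gamma>)"
      using s_minus inv_DirProd[OF is_group group_additive s_closed[OF \<gamma>(1)], of \<gamma>] by simp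
    then show "inv\<^bsub>?G\<^esub> a \<in> ?L" using minus_\<Gamma>[OF \<gamma>(1)] by blast
    fix b assume "b \<in> ?L"
    then obtain \<delta> where \<delta>: "\<delta> \<in> \<Gamma>" "b = (s \<delta>, \<delta>)" by blast
    have "a \<otimes>\<^bsub>?G\<^esub> b = (s (\<gamma> + \<delta>), \<gamma> + \<delta>)" using \<gamma> \<delta> s_add by simp
    then show "a \<otimes>\<^bsub>?G\<^esub> b \<in> ?L" using add_\<Gamma>[OF \<gamma>(1) \<delta>(1)] by blast
  qed
  have discrete: "discrete_topology ?L = subtopology ?PT ?L"
    unfolding discrete_topology_unique
  proof (intro conjI ballI)
    show "topspace (subtopology ?PT ?L) = ?L" using s_closed by auto
    fix x assume "x \<in> ?L"
    then obtain \<gamma> where \<gamma>: "\<gamma> \<in> \<Gamma>" "x = (s \<gamma>, \<gamma>)" by blast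
    have sc: "s \<gamma> \<in> carrier H" using s_closed \<gamma>(1) .
    obtain N r where N: "openin ?T N" "\<one> \<in> N" "r > 0"
      "\<And>\<delta>. \<delta> \<in> \<Gamma> \<Longrightarrow> s \<delta> \<in> N \<Longrightarrow> norm \<delta> < r \<Longrightarrow> \<delta> = 0"
      using s_isolated_zero by blast
    let ?A = "{h \<in> carrier H. inv (s \<gamma>) \<otimes> h \<in> N}"
    have "openin ?T ?A" using sc by (intro openin_preimage_mult N(1)) simp
    then have "openin ?PT (?A \<times> ball \<gamma> r)" by (simp add: openin_prod_Times_iff)
    moreover have "{x} = (?A \<times> ball \<gamma> r) \<inter> ?L"
    proof (intro equalityI subsetI)
      fix y assume "y \<in> {x}"
      then show "y \<in> (?A \<times> ball \<gamma> r) \<inter> ?L" using \<gamma> sc N(2,3) by auto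
    next
      fix y assume y: "y \<in> (?A \<times> ball \<gamma> r) \<inter> ?L"
      then obtain \<delta> where \<delta>: "\<delta> \<in> \<Gamma>" "y = (s \<delta>, \<delta>)" by blast
      have "s (\<delta> - \<gamma>) = inv (s \<gamma>) \<otimes> s \<delta>"
        using s_add[OF \<delta>(1) minus_\<Gamma>[OF \<gamma>(1)]] s_minus[OF \<gamma>(1)] sc s_closed[OF \<delta>(1)]
        by (simp add: m_comm)
      then have "s (\<delta> - \<gamma>) \<in> N" using y \<delta>(2) by simp
      moreover have "norm (\<delta> - \<gamma>) < r" using y \<delta>(2) by (simp add: dist_norm norm_minus_commute)
      ultimately have "\<delta> - \<gamma> = 0" using N(4) diff_\<Gamma> \<delta>(1) \<gamma>(1) by blast
      then show "y \<in> {x}" using \<gamma> \<delta> by simp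
    qed
    ultimately show "openin (subtopology ?PT ?L) {x}"
      unfolding openin_subtopology by blast
  qed
  let ?f = "\<lambda>x. ?L #>\<^bsub>?G\<^esub> x"
  let ?Q = "quotient_topology ?PT ?f"
  have "compact_space ?Q"
  proof -
    obtain r where r: "r > 0" "\<And>P x. P \<in> hull_of \<Lambda> \<Longrightarrow> \<exists>y\<in>support P. dist x y \<le> r"
      using relatively_dense_radius by blast
    \<comment> \<open>\<open>K\<close> times a ball of radius \<open>r\<close> meets every coset: if
      \<open>P\<close> represents \<open>h\<close> and \<open>p\<close> is a support point of
      \<open>P\<close> within \<open>r\<close> of \<open>t\<close>, the graph element at
      \<open>- p\<close> moves \<open>(h, t)\<close> into it.\<close>
    define K where "K = (\<Union>i. cls ` Xi \<Lambda> i)"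
    have K: "compactin ?T K"
      unfolding K_def by (intro compactin_Union)
        (use Xi_subset in \<open>auto intro!: compactin_cls compactin_Xi\<close>)
    then have "compactin ?PT (K \<times> cball 0 r)" by (simp add: compactin_Times)
    then have c: "compactin ?Q (?f ` (K \<times> cball 0 r))"
      using quotient_imp_continuous_map[OF quotient_map_quotient_topology] image_compactin by blast
    have "?f ` topspace ?PT \<subseteq> ?f ` (K \<times> cball 0 r)"
    proof
      fix z assume "z \<in> ?f ` topspace ?PT"
      then obtain h t where h: "h \<in> carrier H" "z = ?f (h, t)" by auto
      then obtain P where P: "P \<in> Xi_group \<Lambda>" "h = cls P" unfolding carrier_H by blast
      obtain p where p: "p \<in> support P" "dist t p \<le> r" using r(2) Xi_group_hull[OF P(1)] by blast
      have p\<Gamma>: "- p \<in> \<Gamma>" using minus_\<Gamma> Xi_group_support[OF P(1) p(1)] by blast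
      obtain i where i: "p \<in> P i" using p(1) by (auto simp: support_def)
      have "translate P (- p) \<in> Xi \<Lambda> i"
        using i translate_hull[OF Xi_group_hull[OF P(1)]] by (simp add: Xi_def mem_translate)
      then have "s (- p) \<otimes> h \<in> K"
        unfolding K_def P(2) cls_translate[OF P(1) p\<Gamma>, symmetric] by blast
      moreover have "t - p \<in> cball 0 r" using p(2) by (simp add: dist_norm norm_minus_commute)
      ultimately have mem: "(s (- p) \<otimes> h, t - p) \<in> K \<times> cball 0 r" by blast
      have "(s (- p), - p) \<otimes>\<^bsub>?G\<^esub> (h, t) \<in> ?L #>\<^bsub>?G\<^esub> (h, t)"
        unfolding r_coset_def using p\<Gamma> by blast
      then have "(s (- p) \<otimes> h, t - p) \<in> ?L #>\<^bsub>?G\<^esub> (h, t)" by simp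
      then have "?f (h, t) = ?f (s (- p) \<otimes> h, t - p)"
        using G.repr_independence sub h(1) by auto
      then show "z \<in> ?f ` (K \<times> cball 0 r)" using h(2) mem by blast
    qed
    moreover have "?f ` (K \<times> cball 0 r) \<subseteq> topspace ?Q"
      using compactin_subset_topspace[OF c] .
    ultimately have "topspace ?Q = ?f ` (K \<times> cball 0 r)"
      unfolding topspace_quotient_topology by blast
    then show ?thesis using c by (simp add: compact_space_def)
  qed
  then have "lattice_in ?G ?PT ?L"
    using sub discrete by (simp add: lattice_in_def)
  then show ?thesis
    unfolding cut_project_scheme_def
    using lca countable_\<Gamma> subgroup_\<Gamma> s_hom dense_range by blast
qed

section \<open>Comparison with another model multiple set\<close>

locale srp_cps_extension = srp_cps \<Lambda> H + M: cps H' T' \<Gamma>' s'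
  for \<Lambda> :: "'i::finite \<Rightarrow> 'a::euclidean_space set"
    and H :: "('i \<Rightarrow> 'a set) set monoid" (structure)
    and H' :: "'h monoid" and T' :: "'h topology" and \<Gamma>' :: "'a set" and s' :: "'a \<Rightarrow> 'h" +
  fixes W' :: "'i \<Rightarrow> 'h set"
  assumes window': "window T' W'" and sub_W': "\<And>i. \<Lambda> i \<subseteq> cut_project_set \<Gamma>' s' (W' i)"
begin

lemma s'_\<Lambda>: "x \<in> \<Lambda> i \<Longrightarrow> x \<in> \<Gamma>'" "x \<in> \<Lambda> i \<Longrightarrow> s' x \<in> W' i"
  using sub_W'[of i] by (auto simp: cut_project_set_def)

lemma \<Gamma>_\<Gamma>': "x \<in> \<Gamma> \<Longrightarrow> x \<in> \<Gamma>'"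
proof -
  have "support \<Lambda> \<subseteq> \<Gamma>'" using s'_\<Lambda>(1) by (auto simp: support_def)
  then have "\<Gamma> \<subseteq> \<Gamma>'"
    unfolding support_group_def
    by (rule group.generate_subgroup_incl[OF group_additive _ M.subgroup_\<Gamma>])
  then show "x \<in> \<Gamma> \<Longrightarrow> x \<in> \<Gamma>'" by blast
qed

lemma compact_W': "compactin T' (W' i)"
  using window' by (simp add: window_def)

section \<open>Closures of the images and limits of return vectors\<close>

definition V :: "'i \<Rightarrow> 'h set" where "V i = T' closure_of (s' ` \<Lambda> i)"

lemma V_subset: "V i \<subseteq> W' i"
  unfolding V_def using s'_\<Lambda>(2)
  by (intro closure_of_minimal M.compactin_closedin[OF compact_W']) blast

lemma closed_V: "closedin T' (V i)"
  by (simp add: V_def)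

lemma compact_V: "compactin T' (V i)"
  using closed_compactin[OF compact_W' V_subset closed_V] .

lemma s'_V: "x \<in> \<Lambda> i \<Longrightarrow> s' x \<in> V i"
  using closure_of_subset[of "s' ` \<Lambda> i" T'] M.s_closed s'_\<Lambda>(1) unfolding V_def by fastforce

lemma V_carrier: "v \<in> V i \<Longrightarrow> v \<in> carrier H'"
  using compactin_subset_topspace[OF compact_V] by fastforce

definition ret :: "real \<Rightarrow> 'a set" where
  "ret \<rho> = {w \<in> \<Gamma>. agree \<rho> (translate \<Lambda> (- w)) \<Lambda>}"

text \<open>As \<open>ret\<close> decreases with the radius, this is the cluster set of
  \<open>s' w\<close> along return vectors \<open>w\<close> of growing radius.\<close>

definition G :: "'h set" where
  "G = (\<Inter>n::nat. T' closure_of (s' ` ret n))"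

lemma ret_\<Gamma>': "w \<in> ret \<rho> \<Longrightarrow> w \<in> \<Gamma>'"
  using \<Gamma>_\<Gamma>' by (simp add: ret_def)

lemma ret_antimono: "\<rho> \<le> \<sigma> \<Longrightarrow> ret \<sigma> \<subseteq> ret \<rho>"
  unfolding ret_def using agree_mono by blast

lemma ret_shift: "w \<in> ret \<rho> \<Longrightarrow> x \<in> \<Lambda> i \<Longrightarrow> norm x \<le> \<rho> \<Longrightarrow> x + w \<in> \<Lambda> i"
  unfolding ret_def using agreeD[of \<rho> "translate \<Lambda> (- w)" \<Lambda> x i] by (simp add: mem_translate)

text \<open>Once the ball contains a support point \<open>x\<close>, also \<open>x + w\<close> is a
  support point, so \<open>w\<close> is a difference of elements of \<Gamma>.\<close>

lemma ret_large:
  obtains \<rho>0 where "\<And>\<rho> w. \<rho> \<ge> \<rho>0 \<Longrightarrow> agree \<rho> (translate \<Lambda> (- w)) \<Lambda> \<Longrightarrow> w \<in> ret \<rho>"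
proof -
  obtain x where x: "x \<in> support \<Lambda>" using support_nonempty by blast
  have "w \<in> ret \<rho>" if "\<rho> \<ge> norm x" "agree \<rho> (translate \<Lambda> (- w)) \<Lambda>" for \<rho> w
  proof -
    have "x + w \<in> support \<Lambda>"
      using agree_support[OF that(2,1)] x by (simp add: mem_support_translate)
    then have "x + w - x \<in> \<Gamma>" using x by (intro diff_\<Gamma> support_\<Gamma>)
    then show ?thesis using that(2) by (simp add: ret_def)
  qed
  then show ?thesis using that by blast
qed

text \<open>A return vector \<open>w\<close> moves the visible point \<open>x\<close> to a point of
  \<open>\<Lambda> i\<close>; for fixed \<open>x\<close> the resulting condition on
  \<open>s' w\<close> is closed.\<close>

lemma closure_ret:
  assumes "x \<in> \<Lambda> i" "norm x \<le> \<rho>" "h \<in> T' closure_of (s' ` ret \<rho>)"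
  shows "s' x \<otimes>\<^bsub>H'\<^esub> h \<in> V i"
proof -
  let ?K = "{h \<in> carrier H'. s' x \<otimes>\<^bsub>H'\<^esub> h \<in> V i}"
  have x: "x \<in> \<Gamma>'" using s'_\<Lambda>(1)[OF assms(1)] .
  have "T' closure_of (s' ` ret \<rho>) \<subseteq> ?K"
  proof (rule closure_of_minimal)
    show "closedin T' ?K" by (rule M.closedin_preimage_mult[OF closed_V M.s_closed[OF x]])
    show "s' ` ret \<rho> \<subseteq> ?K"
    proof (rule image_subsetI)
      fix w assume w: "w \<in> ret \<rho>"
      then have "s' (x + w) \<in> V i" using s'_V ret_shift assms by blast
      then show "s' w \<in> ?K" using M.s_add[OF x ret_\<Gamma>'[OF w]] M.s_closed[OF ret_\<Gamma>'[OF w]] by simp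
    qed
  qed
  then show ?thesis using assms(3) by blast
qed

lemma G_carrier: "g \<in> G \<Longrightarrow> g \<in> carrier H'"
proof -
  assume "g \<in> G"
  then have "g \<in> T' closure_of (s' ` ret (real 0))" unfolding G_def by blast
  then show "g \<in> carrier H'" using closure_of_subset_topspace[of T'] by fastforce
qed

text \<open>Each point of \<open>\<Lambda> i\<close> is visible at some radius \<open>n\<close>, and
  \<open>G\<close> lies in the closure belonging to every \<open>n\<close>; closedness then extends
  the inclusion from the image of \<open>\<Lambda> i\<close> to \<open>V i\<close>.\<close>

lemma V_G:
  assumes "v \<in> V i" "g \<in> G"
  shows "v \<otimes>\<^bsub>H'\<^esub> g \<in> V i"
proof -
  let ?K = "{h \<in> carrier H'. g \<otimes>\<^bsub>H'\<^esub> h \<in> V i}"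
  have "V i \<subseteq> ?K"
    unfolding V_def[of i]
  proof (rule closure_of_minimal)
    show "closedin T' {h \<in> carrier H'. g \<otimes>\<^bsub>H'\<^esub> h \<in> T' closure_of (s' ` \<Lambda> i)}"
      by (rule M.closedin_preimage_mult[OF _ G_carrier[OF assms(2)]]) simp
    show "s' ` \<Lambda> i \<subseteq> {h \<in> carrier H'. g \<otimes>\<^bsub>H'\<^esub> h \<in> T' closure_of (s' ` \<Lambda> i)}"
    proof (rule image_subsetI)
      fix x assume x: "x \<in> \<Lambda> i"
      obtain n :: nat where n: "norm x \<le> n" using real_arch_simple by blast
      have "g \<in> T' closure_of (s' ` ret n)" using assms(2) unfolding G_def by blast
      from closure_ret[OF x n this] have "s' x \<otimes>\<^bsub>H'\<^esub> g \<in> V i" .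
      moreover have "s' x \<in> carrier H'" using M.s_closed s'_\<Lambda>(1)[OF x] .
      ultimately show "s' x \<in> {h \<in> carrier H'. g \<otimes>\<^bsub>H'\<^esub> h \<in> T' closure_of (s' ` \<Lambda> i)}"
        using M.m_comm[OF _ G_carrier[OF assms(2)]] by (simp add: V_def)
    qed
  qed
  then show ?thesis
    using assms V_carrier[OF assms(1)] M.m_comm[OF G_carrier[OF assms(2)]] by fastforce
qed

lemma V_inv_G:
  assumes "v \<in> V i" "g \<in> G"
  shows "v \<otimes>\<^bsub>H'\<^esub> inv\<^bsub>H'\<^esub> g \<in> V i"
  by (rule M.compact_semistable[OF compact_V G_carrier[OF assms(2)] _ assms(1)])
    (rule V_G[OF _ assms(2)])

text \<open>The closures \<open>K n\<close> decrease to \<open>G\<close> and are compact from stage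
  \<open>m\<close> on, being contained in a translate of \<open>V i\<close>; hence they eventually
  lie in the open set \<open>Q\<close> around \<open>G\<close>.\<close>

lemma ret_near_G:
  assumes N: "openin T' N" "\<one>\<^bsub>H'\<^esub> \<in> N"
  obtains \<rho> where "\<And>w. w \<in> ret \<rho> \<Longrightarrow> \<exists>g\<in>G. inv\<^bsub>H'\<^esub> g \<otimes>\<^bsub>H'\<^esub> s' w \<in> N"
proof -
  define Q where "Q = (\<Union>g\<in>G. {h \<in> carrier H'. inv\<^bsub>H'\<^esub> g \<otimes>\<^bsub>H'\<^esub> h \<in> N})"
  define K where "K n = T' closure_of (s' ` ret (real n))" for n :: nat
  have Q: "openin T' Q"
    unfolding Q_def using G_carrier
    by (intro openin_Union) (auto intro!: M.openin_preimage_mult[OF N(1)])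
  have GQ: "G \<subseteq> Q" unfolding Q_def using G_carrier N(2) by fastforce
  have KK: "K m \<subseteq> K n" if "n \<le> m" for m n
    unfolding K_def using that by (intro closure_of_mono image_mono ret_antimono) simp
  obtain x i where x: "x \<in> \<Lambda> i" using support_nonempty unfolding support_def by blast
  obtain m :: nat where m: "norm x \<le> m" using real_arch_simple by blast
  have sx: "s' x \<in> carrier H'" using M.s_closed s'_\<Lambda>(1)[OF x] .
  have Kc: "K n \<subseteq> carrier H'" for n
    unfolding K_def using closure_of_subset_topspace[of T'] by fastforce
  have "compactin T' ((\<lambda>h. inv\<^bsub>H'\<^esub> (s' x) \<otimes>\<^bsub>H'\<^esub> h) ` V i)"
    using sx by (intro M.compactin_image_mult compact_V) simp
  moreover have "K m \<subseteq> (\<lambda>h. inv\<^bsub>H'\<^esub> (s' x) \<otimes>\<^bsub>H'\<^esub> h) ` V i"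
  proof
    fix h assume h: "h \<in> K m"
    have "s' x \<otimes>\<^bsub>H'\<^esub> h \<in> V i" using closure_ret[OF x m] h unfolding K_def .
    moreover have "h = inv\<^bsub>H'\<^esub> (s' x) \<otimes>\<^bsub>H'\<^esub> (s' x \<otimes>\<^bsub>H'\<^esub> h)"
      using sx h Kc by (simp add: M.m_assoc[symmetric] subset_iff)
    ultimately show "h \<in> (\<lambda>h. inv\<^bsub>H'\<^esub> (s' x) \<otimes>\<^bsub>H'\<^esub> h) ` V i" by blast
  qed
  moreover have "closedin T' (K m)" by (simp add: K_def)
  ultimately have comp: "compactin T' (K m)" by (rule closed_compactin)
  let ?c = "\<lambda>n. carrier H' - K n"
  have c: "openin T' (?c n)" for n
    using openin_diff[OF openin_topspace[of T'], of "K n"] by (simp add: K_def)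
  have "K m \<subseteq> \<Union>(insert Q (range ?c))"
  proof
    fix h assume h: "h \<in> K m"
    show "h \<in> \<Union>(insert Q (range ?c))"
    proof (cases "h \<in> G")
      case False
      then obtain n where "h \<notin> K n" unfolding G_def K_def by blast
      then show ?thesis using h Kc by blast
    qed (use GQ in blast)
  qed
  moreover have "\<forall>U\<in>insert Q (range ?c). openin T' U" using Q c by blast
  ultimately obtain \<F> where \<F>: "finite \<F>" "\<F> \<subseteq> insert Q (range ?c)" "K m \<subseteq> \<Union>\<F>"
    using comp unfolding compactin_def by meson
  have "finite (\<F> - {Q})" "\<F> - {Q} \<subseteq> range ?c" using \<F> by auto
  then obtain J where J: "finite J" "\<F> - {Q} = ?c ` J"
    by (meson finite_subset_image)
  \<comment> \<open>Including \<open>m\<close> keeps \<open>K n\<close> inside the compact set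
    \<open>K m\<close>; \<open>J\<close> lists the stages whose complements occur in the finite
    subcover.\<close>
  define n where "n = Max (insert m J)"
  have "s' w \<in> Q" if w: "w \<in> ret n" for w
  proof -
    have "s' w \<in> K n"
      unfolding K_def using closure_of_subset[of "s' ` ret n" T'] M.s_closed[OF ret_\<Gamma>'] w by fastforce
    moreover have "K n \<subseteq> K m" unfolding n_def using J(1) by (intro KK) simp
    ultimately obtain U where U: "U \<in> \<F>" "s' w \<in> U" using \<F>(3) by blast
    show ?thesis
    proof (rule ccontr)
      assume "s' w \<notin> Q"
      then have "U \<in> ?c ` J" using U J(2) by blast
      then obtain j where j: "j \<in> J" "s' w \<notin> K j" using U(2) by blast
      have "K n \<subseteq> K j" unfolding n_def using J(1) j(1) by (intro KK) simp
      then show False using \<open>s' w \<in> K n\<close> j(2) by blast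
    qed
  qed
  then have "\<exists>g\<in>G. inv\<^bsub>H'\<^esub> g \<otimes>\<^bsub>H'\<^esub> s' w \<in> N" if "w \<in> ret n" for w
    using that unfolding Q_def by blast
  then show ?thesis by (rule that)
qed


text \<open>Repetitivity gives a shift for each pattern; compactness of the sets \<open>Xi\<close>
  reduces these to finitely many, and every \<open>y\<close> is within \<open>r\<close> of a point
  of \<Lambda>, so the bound does not depend on \<open>y\<close>.\<close>

lemma uniform_recurrence:
  obtains R where "\<And>y. \<exists>v. norm v \<le> R \<and> agree \<rho> (translate \<Lambda> (- (y + v))) \<Lambda>"
proof -
  define O' where "O' v = {Q \<in> hull_of \<Lambda>. agree \<rho> \<Lambda> (translate Q v)}" for v
  have \<Lambda>h: "\<Lambda> \<in> hull_of \<Lambda>" using translate_self_hull[of \<Lambda> 0] by simp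
  have open_O: "openin (comb_topology \<Lambda>) (O' v)" for v
  proof -
    have "openin (comb_topology \<Lambda>) {Q \<in> topspace (comb_topology \<Lambda>).
        translate Q v \<in> {Q \<in> hull_of \<Lambda>. agree \<rho> \<Lambda> Q}}"
      by (rule openin_continuous_map_preimage[OF continuous_translate openin_comb_cylinder])
    also have "{Q \<in> topspace (comb_topology \<Lambda>).
        translate Q v \<in> {Q \<in> hull_of \<Lambda>. agree \<rho> \<Lambda> Q}} = O' v"
      using translate_hull unfolding O'_def by auto
    finally show ?thesis .
  qed
  have "\<exists>B. finite B \<and> Xi \<Lambda> i \<subseteq> \<Union>(O' ` B)" for i
  proof -
    have "Xi \<Lambda> i \<subseteq> \<Union>(range O')"
    proof
      fix Q assume "Q \<in> Xi \<Lambda> i"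
      then have Q: "Q \<in> hull_of \<Lambda>" by (rule Xi_hull)
      obtain v where "agree \<rho> \<Lambda> (translate Q v)" using repetitive_translate[OF repetitive \<Lambda>h Q] .
      then show "Q \<in> \<Union>(range O')" using Q unfolding O'_def by blast
    qed
    moreover have "\<forall>U\<in>range O'. openin (comb_topology \<Lambda>) U" using open_O by blast
    ultimately obtain \<F> where "finite \<F>" "\<F> \<subseteq> range O'" "Xi \<Lambda> i \<subseteq> \<Union>\<F>"
      using compactin_Xi unfolding compactin_def by meson
    then show ?thesis by (metis finite_subset_image)
  qed
  then have "\<forall>i. \<exists>B. finite B \<and> Xi \<Lambda> i \<subseteq> \<Union>(O' ` B)" by blast
  from choice[OF this] obtain B where B: "\<forall>i. finite (B i) \<and> Xi \<Lambda> i \<subseteq> \<Union>(O' ` B i)"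
    by (rule exE)
  have "finite (\<Union>i. B i)" using B by simp
  then obtain M where M: "\<And>b. b \<in> (\<Union>i. B i) \<Longrightarrow> norm b \<le> M"
    using bounded_iff finite_imp_bounded by metis
  obtain r where r: "r > 0" "\<And>P x. P \<in> hull_of \<Lambda> \<Longrightarrow> \<exists>y\<in>support P. dist x y \<le> r"
    using relatively_dense_radius by blast
  have "\<exists>v. norm v \<le> r + M \<and> agree \<rho> (translate \<Lambda> (- (y + v))) \<Lambda>" for y
  proof -
    obtain x where x: "x \<in> support \<Lambda>" "dist y x \<le> r" using r(2)[OF \<Lambda>h] by blast
    obtain i where i: "x \<in> \<Lambda> i" using x(1) by (auto simp: support_def)
    have "translate \<Lambda> (- x) \<in> Xi \<Lambda> i"
      using i translate_self_hull by (simp add: Xi_def mem_translate)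
    then obtain b where b: "b \<in> B i" "translate \<Lambda> (- x) \<in> O' b" using B by blast
    then have "agree \<rho> \<Lambda> (translate \<Lambda> (- x + b))" unfolding O'_def by simp
    then have "agree \<rho> (translate \<Lambda> (- (y + (x - y - b)))) \<Lambda>"
      using agree_sym by (simp add: algebra_simps)
    moreover have "norm (x - y - b) \<le> r + M"
      using norm_triangle_ineq4[of "x - y" b] x(2) M[of b] b(1)
      by (fastforce simp: dist_norm norm_minus_commute)
    ultimately show ?thesis by blast
  qed
  then show ?thesis by (rule that)
qed

text \<open>Some \<open>P\<close> with 0 in \<open>P i\<close> is proximal to \<Lambda> - \<gamma>.
  Its companions look like \<Lambda> - a and \<Lambda> - b on a large ball: the centre of the first
  gives \<open>a \<in> \<Lambda> i\<close>, that of the second gives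
  \<open>w = b - \<gamma>\<close>, and a recurrence near the patch shared at \<open>t\<close> gives
  \<open>q = b + t + v\<close> and \<open>p = a + t + v\<close>.\<close>

lemma s_window_decomposition:
  assumes "\<gamma> \<in> \<Gamma>" "s \<gamma> \<in> srp_window \<Lambda> H i"
  obtains a p q w where "a \<in> \<Lambda> i" "p \<in> ret \<rho>" "q \<in> ret \<rho>" "w \<in> ret \<rho>" "\<gamma> = a + q - p - w"
proof -
  obtain P where P: "P \<in> Xi \<Lambda> i" "s \<gamma> = inv (cls P)" using assms(2) by (auto simp: srp_window_def)
  have "cls P = s (- \<gamma>)"
    using P s_minus[OF assms(1)] cls_closed[OF Xi_subset[OF P(1)]] by simp
  then have srp: "srp \<Lambda> P (translate \<Lambda> (- \<gamma>))"
    by (intro srp_class_eqD translate_self_hull) (simp add: s_cls)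
  obtain \<rho>0 where \<rho>0: "\<And>\<rho> w. \<rho> \<ge> \<rho>0 \<Longrightarrow> agree \<rho> (translate \<Lambda> (- w)) \<Lambda> \<Longrightarrow> w \<in> ret \<rho>"
    using ret_large by blast
  define \<sigma> where "\<sigma> = max \<rho> \<rho>0"
  have ret: "w \<in> ret \<rho>" if "agree \<sigma> (translate \<Lambda> (- w)) \<Lambda>" for w
  proof -
    have "w \<in> ret \<sigma>" using \<rho>0[of \<sigma>] that by (simp add: \<sigma>_def)
    moreover have "ret \<sigma> \<subseteq> ret \<rho>" by (rule ret_antimono) (simp add: \<sigma>_def)
    ultimately show ?thesis by blast
  qed
  obtain R0 where R0: "\<And>y. \<exists>v. norm v \<le> R0 \<and> agree \<sigma> (translate \<Lambda> (- (y + v))) \<Lambda>"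
    using uniform_recurrence by blast
  \<comment> \<open>\<open>\<sigma> + R0\<close> pays for the shift by \<open>v\<close> to the
    recurrence, \<open>\<sigma> + norm \<gamma>\<close> for undoing the shift by \<gamma>, and 1
    secures positivity.\<close>
  define R where "R = max 1 (max (\<sigma> + R0) (\<sigma> + norm \<gamma>))"
  have R: "R > 0" "\<sigma> + R0 \<le> R" "\<sigma> + norm \<gamma> \<le> R" by (auto simp: R_def)
  obtain P1 P2 t where P12: "P1 \<in> hull_of \<Lambda>" "P2 \<in> hull_of \<Lambda>" "agree R P P1"
    "agree R (translate \<Lambda> (- \<gamma>)) P2" "agree R (translate P1 (- t)) (translate P2 (- t))"
    using srpD[OF srp R(1)] .
  \<comment> \<open>The extra \<open>norm t\<close> lets the agreement survive the shift by
    \<open>- t\<close>.\<close>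
  obtain a where a: "agree (R + norm t) P1 (translate \<Lambda> (- a))" using hull_agree[OF P12(1)] by blast
  obtain b where b: "agree (R + norm t) P2 (translate \<Lambda> (- b))" using hull_agree[OF P12(2)] by blast
  have "agree R P (translate \<Lambda> (- a))"
    using agree_trans[OF P12(3) agree_mono[OF a]] by simp
  then have a\<Lambda>: "a \<in> \<Lambda> i"
    using agreeD[of R P "translate \<Lambda> (- a)" 0 i] Xi_mem[OF P(1)] R(1) by (simp add: mem_translate)
  have b\<gamma>: "b - \<gamma> \<in> ret \<rho>"
  proof (rule ret)
    have "agree R (translate \<Lambda> (- b)) (translate \<Lambda> (- \<gamma>))"
      using agree_trans[OF P12(4) agree_mono[OF b]] agree_sym by simp
    from agree_translate[OF this R(3)]
    show "agree \<sigma> (translate \<Lambda> (- (b - \<gamma>))) \<Lambda>" by simp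
  qed
  obtain v where v: "norm v \<le> R0" "agree \<sigma> (translate \<Lambda> (- (b + t + v))) \<Lambda>"
    using R0 by blast
  have "agree R (translate \<Lambda> (- a - t)) (translate \<Lambda> (- b - t))"
    using agree_trans[OF agree_trans[OF agree_sym[OF agree_translate[OF a, of R "- t"]] P12(5)]
        agree_translate[OF b, of R "- t"]] by simp
  then have "agree \<sigma> (translate (translate \<Lambda> (- a - t)) (- v)) (translate (translate \<Lambda> (- b - t)) (- v))"
    by (rule agree_translate) (use v(1) R(2) in simp)
  moreover have "- a - t + - v = - (a + t + v)" "- b - t + - v = - (b + t + v)"
    by simp_all
  ultimately have "agree \<sigma> (translate \<Lambda> (- (a + t + v))) (translate \<Lambda> (- (b + t + v)))"
    by (metis translate_translate)
  from agree_trans[OF this v(2)] have "a + t + v \<in> ret \<rho>" by (rule ret)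
  then show ?thesis by (rule that[OF a\<Lambda> _ ret[OF v(2)] b\<gamma>]) simp
qed

lemma s'_window:
  assumes "\<gamma> \<in> \<Gamma>" "s \<gamma> \<in> srp_window \<Lambda> H i"
  shows "s' \<gamma> \<in> V i"
proof (rule M.closure_nhd[OF closed_V])
  show "s' \<gamma> \<in> carrier H'" using M.s_closed \<Gamma>_\<Gamma>' assms(1) by blast
  fix N assume N: "openin T' N" "\<one>\<^bsub>H'\<^esub> \<in> N"
  obtain M1 where M1: "openin T' M1" "\<one>\<^bsub>H'\<^esub> \<in> M1"
    "\<And>x y. x \<in> M1 \<Longrightarrow> y \<in> M1 \<Longrightarrow> inv\<^bsub>H'\<^esub> x \<otimes>\<^bsub>H'\<^esub> y \<in> N"
    using M.nhd_diff[OF N] by metis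
  obtain M2 where M2: "openin T' M2" "\<one>\<^bsub>H'\<^esub> \<in> M2"
    "\<And>x y. x \<in> M2 \<Longrightarrow> y \<in> M2 \<Longrightarrow> inv\<^bsub>H'\<^esub> x \<otimes>\<^bsub>H'\<^esub> y \<in> M1"
    using M.nhd_diff[OF M1(1,2)] by metis
  have "openin T' (M1 \<inter> M2)" "\<one>\<^bsub>H'\<^esub> \<in> M1 \<inter> M2" using M1 M2 by auto
  then obtain \<rho> where \<rho>: "\<And>w. w \<in> ret \<rho> \<Longrightarrow> \<exists>g\<in>G. inv\<^bsub>H'\<^esub> g \<otimes>\<^bsub>H'\<^esub> s' w \<in> M1 \<inter> M2"
    using ret_near_G by blast
  obtain a p q w where d: "a \<in> \<Lambda> i" "p \<in> ret \<rho>" "q \<in> ret \<rho>" "w \<in> ret \<rho>" "\<gamma> = a + q - p - w"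
    using s_window_decomposition[OF assms] .
  obtain g1 where g1: "g1 \<in> G" "inv\<^bsub>H'\<^esub> g1 \<otimes>\<^bsub>H'\<^esub> s' p \<in> M1 \<inter> M2" using \<rho> d(2) by blast
  obtain g2 where g2: "g2 \<in> G" "inv\<^bsub>H'\<^esub> g2 \<otimes>\<^bsub>H'\<^esub> s' q \<in> M1 \<inter> M2" using \<rho> d(3) by blast
  obtain g3 where g3: "g3 \<in> G" "inv\<^bsub>H'\<^esub> g3 \<otimes>\<^bsub>H'\<^esub> s' w \<in> M1 \<inter> M2" using \<rho> d(4) by blast
  have mem: "a \<in> \<Gamma>'" "p \<in> \<Gamma>'" "q \<in> \<Gamma>'" "w \<in> \<Gamma>'" using s'_\<Lambda>(1) ret_\<Gamma>' d by auto
  have car: "s' a \<in> carrier H'" "s' p \<in> carrier H'" "s' q \<in> carrier H'" "s' w \<in> carrier H'"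
    "g1 \<in> carrier H'" "g2 \<in> carrier H'" "g3 \<in> carrier H'"
    using mem M.s_closed G_carrier g1(1) g2(1) g3(1) by auto
  \<comment> \<open>The candidate mirrors \<open>\<gamma> = a + q - p - w\<close> with each return
    vector replaced by a nearby element of \<open>G\<close>, so it lies in \<open>V i\<close>; its
    quotient to \<open>s' \<gamma>\<close> is made up of the three errors \<open>n\<close>.\<close>
  define c where "c = s' a \<otimes>\<^bsub>H'\<^esub> g2 \<otimes>\<^bsub>H'\<^esub> inv\<^bsub>H'\<^esub> g1 \<otimes>\<^bsub>H'\<^esub> inv\<^bsub>H'\<^esub> g3"
  define n where "n g x = inv\<^bsub>H'\<^esub> g \<otimes>\<^bsub>H'\<^esub> s' x" for g x
  have "c \<in> V i"
    unfolding c_def by (intro V_inv_G V_G s'_V d(1) g1(1) g2(1) g3(1))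
  moreover have "inv\<^bsub>H'\<^esub> c \<otimes>\<^bsub>H'\<^esub> s' \<gamma> = inv\<^bsub>H'\<^esub> (n g3 w) \<otimes>\<^bsub>H'\<^esub> (inv\<^bsub>H'\<^esub> (n g1 p) \<otimes>\<^bsub>H'\<^esub> n g2 q)"
  proof -
    have "s' \<gamma> = s' (a + q - p - w)" using d(5) by simp
    also have "\<dots> = inv\<^bsub>H'\<^esub> (s' w) \<otimes>\<^bsub>H'\<^esub> (inv\<^bsub>H'\<^esub> (s' p) \<otimes>\<^bsub>H'\<^esub> (s' a \<otimes>\<^bsub>H'\<^esub> s' q))"
      using mem by (simp add: M.s_diff M.s_add M.add_\<Gamma> M.diff_\<Gamma>)
    finally have s\<gamma>: "s' \<gamma> = inv\<^bsub>H'\<^esub> (s' w) \<otimes>\<^bsub>H'\<^esub> (inv\<^bsub>H'\<^esub> (s' p) \<otimes>\<^bsub>H'\<^esub> (s' a \<otimes>\<^bsub>H'\<^esub> s' q))" .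
    have "inv\<^bsub>H'\<^esub> c = inv\<^bsub>H'\<^esub> (s' a) \<otimes>\<^bsub>H'\<^esub> (inv\<^bsub>H'\<^esub> g2 \<otimes>\<^bsub>H'\<^esub> (g1 \<otimes>\<^bsub>H'\<^esub> g3))"
      unfolding c_def using car by (simp add: M.inv_mult M.m_assoc)
    then have "inv\<^bsub>H'\<^esub> c \<otimes>\<^bsub>H'\<^esub> s' \<gamma> = inv\<^bsub>H'\<^esub> (s' a) \<otimes>\<^bsub>H'\<^esub> (s' a \<otimes>\<^bsub>H'\<^esub>
        ((g3 \<otimes>\<^bsub>H'\<^esub> inv\<^bsub>H'\<^esub> (s' w)) \<otimes>\<^bsub>H'\<^esub> ((g1 \<otimes>\<^bsub>H'\<^esub> inv\<^bsub>H'\<^esub> (s' p)) \<otimes>\<^bsub>H'\<^esub> (inv\<^bsub>H'\<^esub> g2 \<otimes>\<^bsub>H'\<^esub> s' q))))"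
      unfolding s\<gamma> using car by (simp add: M.m_ac)
    also have "\<dots> = (g3 \<otimes>\<^bsub>H'\<^esub> inv\<^bsub>H'\<^esub> (s' w)) \<otimes>\<^bsub>H'\<^esub> ((g1 \<otimes>\<^bsub>H'\<^esub> inv\<^bsub>H'\<^esub> (s' p)) \<otimes>\<^bsub>H'\<^esub> (inv\<^bsub>H'\<^esub> g2 \<otimes>\<^bsub>H'\<^esub> s' q))"
      using car by (simp add: M.m_assoc[symmetric])
    also have "\<dots> = inv\<^bsub>H'\<^esub> (n g3 w) \<otimes>\<^bsub>H'\<^esub> (inv\<^bsub>H'\<^esub> (n g1 p) \<otimes>\<^bsub>H'\<^esub> n g2 q)"
      unfolding n_def using car by (simp add: M.inv_mult)
    finally show ?thesis .
  qed
  moreover have "\<dots> \<in> N"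
  proof -
    have "n g3 w \<in> M1" "n g1 p \<in> M2" "n g2 q \<in> M2"
      using g1(2) g2(2) g3(2) by (simp_all add: n_def)
    then show ?thesis by (intro M1(3) M2(3))
  qed
  ultimately show "\<exists>c\<in>V i. inv\<^bsub>H'\<^esub> c \<otimes>\<^bsub>H'\<^esub> s' \<gamma> \<in> N" by metis
qed

section \<open>Interior points of the windows\<close>

lemma s'_window_interior:
  assumes \<gamma>: "\<gamma> \<in> \<Gamma>" and s\<gamma>: "s \<gamma> \<in> srp_topology \<Lambda> interior_of srp_window \<Lambda> H i"
  shows "s' \<gamma> \<in> T' interior_of W' i"
proof -
  let ?T = "srp_topology \<Lambda>"
  have \<gamma>c: "s \<gamma> \<in> carrier H" "s' \<gamma> \<in> carrier H'" "\<gamma> \<in> \<Gamma>'"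
    using s_closed M.s_closed \<Gamma>_\<Gamma>' \<gamma> by auto
  define U where "U = {h \<in> carrier H. s \<gamma> \<otimes> h \<in> ?T interior_of srp_window \<Lambda> H i}"
  have U: "openin ?T U" "\<one> \<in> U"
    unfolding U_def using \<gamma>c s\<gamma> by (auto intro!: openin_preimage_mult)
  have UW: "s' (\<gamma> + \<delta>) \<in> W' i" if "\<delta> \<in> \<Gamma>" "s \<delta> \<in> U" for \<delta>
  proof -
    have "s (\<gamma> + \<delta>) \<in> ?T interior_of srp_window \<Lambda> H i"
      using that s_add[OF \<gamma> that(1)] by (simp add: U_def)
    then have "s (\<gamma> + \<delta>) \<in> srp_window \<Lambda> H i"
      by (rule subsetD[OF interior_of_subset])
    then show ?thesis using s'_window[OF add_\<Gamma>[OF \<gamma> that(1)]] V_subset by blast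
  qed
  \<comment> \<open>\<open>D0\<close> is cut out by \<open>U0\<close> rather than \<open>U\<close>
    because the end of the argument needs \<open>s\<close> to send differences of its elements into
    \<open>U\<close>.\<close>
  obtain U0 where U0: "openin ?T U0" "\<one> \<in> U0"
    "\<And>x y. x \<in> U0 \<Longrightarrow> y \<in> U0 \<Longrightarrow> inv x \<otimes> y \<in> U"
    using nhd_diff[OF U] by metis
  define D0 where "D0 = {\<delta> \<in> \<Gamma>. s \<delta> \<in> U0}"
  have D0U: "s (\<delta> - \<epsilon>) \<in> U" if "\<delta> \<in> D0" "\<epsilon> \<in> D0" for \<delta> \<epsilon>
  proof -
    have *: "\<delta> \<in> \<Gamma>" "\<epsilon> \<in> \<Gamma>" "s \<delta> \<in> U0" "s \<epsilon> \<in> U0" using that by (auto simp: D0_def)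
    have "s (\<delta> - \<epsilon>) = inv (s \<epsilon>) \<otimes> s \<delta>"
      using s_add[OF *(1) minus_\<Gamma>[OF *(2)]] s_minus[OF *(2)] s_closed *(1,2) by (simp add: m_comm)
    then show ?thesis using U0(3) * by simp
  qed
  have zero_D0: "0 \<in> D0" using U0(2) s_zero by (simp add: D0_def)
  have D0_\<Gamma>': "\<delta> \<in> \<Gamma>'" "\<delta> \<in> \<Gamma>" if "\<delta> \<in> D0" for \<delta> using that \<Gamma>_\<Gamma>' by (auto simp: D0_def)
  \<comment> \<open>Finitely many translates of \<open>U0\<close> by elements \<open>s b\<close>
    cover all components of the window, so a point of \<Lambda> near \<open>y\<close> becomes an
    element of \<open>D0\<close> on subtracting one of finitely many \<open>b\<close>.\<close>
  obtain r where r: "\<And>y. \<exists>\<delta>\<in>D0. norm (y - \<delta>) \<le> r"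
  proof -
    obtain r where r: "r > 0" "\<And>P x. P \<in> hull_of \<Lambda> \<Longrightarrow> \<exists>y\<in>support P. dist x y \<le> r"
      using relatively_dense_radius by blast
    define K where "K = (\<Union>j. srp_window \<Lambda> H j)"
    have K: "compactin ?T K"
      unfolding K_def using window_srp by (intro compactin_Union) (auto simp: window_def)
    have "s ` \<Gamma> \<subseteq> carrier H" using s_closed by blast
    from compact_cover_nhd[OF K U0(1,2) dense_range this]
    obtain F where F: "finite F" "F \<subseteq> s ` \<Gamma>" "\<And>c. c \<in> K \<Longrightarrow> \<exists>f\<in>F. inv f \<otimes> c \<in> U0"
      by blast
    obtain B where B: "finite B" "B \<subseteq> \<Gamma>" "F = s ` B" using F(1,2) by (meson finite_subset_image)
    obtain M where M: "\<And>b. b \<in> B \<Longrightarrow> norm b \<le> M"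
      using B(1) bounded_iff finite_imp_bounded by metis
    have "\<exists>\<delta>\<in>D0. norm (y - \<delta>) \<le> r + M" for y
    proof -
      obtain x where x: "x \<in> support \<Lambda>" "dist y x \<le> r"
        using r(2)[OF translate_self_hull[of \<Lambda> 0]] by auto
      then obtain j where j: "x \<in> \<Lambda> j" by (auto simp: support_def)
      have "s x \<in> K" using s_window(2)[OF j] unfolding K_def by blast
      then obtain b where b: "b \<in> B" "inv (s b) \<otimes> s x \<in> U0" using F(3) B(3) by blast
      have m: "b \<in> \<Gamma>" "x \<in> \<Gamma>" using b(1) B(2) s_window(1)[OF j] by auto
      have "s (x - b) = inv (s b) \<otimes> s x"
        using s_add[OF m(2) minus_\<Gamma>[OF m(1)]] s_minus[OF m(1)] s_closed m by (simp add: m_comm)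
      then have "x - b \<in> D0" using b(2) diff_\<Gamma>[OF m(2,1)] by (simp add: D0_def)
      moreover have "norm (y - (x - b)) \<le> r + M"
        using norm_triangle_ineq[of "y - x" b] x(2) M[OF b(1)] by (simp add: dist_norm algebra_simps)
      ultimately show ?thesis by blast
    qed
    then show thesis by (rule that)
  qed
  define C0 where "C0 = T' closure_of (s' ` D0)"
  have D0_carrier: "s' ` D0 \<subseteq> carrier H'" using M.s_closed D0_\<Gamma>' by blast
  have D0_C0: "s' ` D0 \<subseteq> C0"
    unfolding C0_def using closure_of_subset[of "s' ` D0" T'] D0_carrier by simp
  \<comment> \<open>A compact set containing the image of \<open>D0\<close>, since adding \<gamma>
    sends that image into \<open>W' i\<close>.\<close>
  define A where "A = (\<lambda>h. inv\<^bsub>H'\<^esub> (s' \<gamma>) \<otimes>\<^bsub>H'\<^esub> h) ` W' i"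
  have A: "compactin T' A"
    unfolding A_def using \<gamma>c by (intro M.compactin_image_mult compact_W') simp
  have D0_A: "s' ` D0 \<subseteq> A"
  proof (rule image_subsetI)
    fix \<delta> assume \<delta>: "\<delta> \<in> D0"
    have "s' (\<gamma> + \<delta>) \<in> W' i" using UW[of \<delta>] D0U[OF \<delta> zero_D0] D0_\<Gamma>'[OF \<delta>] by simp
    moreover have "s' \<delta> = inv\<^bsub>H'\<^esub> (s' \<gamma>) \<otimes>\<^bsub>H'\<^esub> s' (\<gamma> + \<delta>)"
      using M.s_diff[OF M.add_\<Gamma>[OF \<gamma>c(3) D0_\<Gamma>'(1)[OF \<delta>]] \<gamma>c(3)] by simp
    ultimately show "s' \<delta> \<in> A" unfolding A_def by blast
  qed
  have C0: "compactin T' C0"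
    unfolding C0_def
    by (rule closed_compactin[OF A closure_of_minimal[OF D0_A M.compactin_closedin[OF A]]]) simp
  obtain B K' where K': "openin T' B" "\<one>\<^bsub>H'\<^esub> \<in> B" "compactin T' K'" "B \<subseteq> K'"
    using M.compact_nhd by blast
  \<comment> \<open>The possible corrections \<open>y - \<delta>\<close> from an element of
    \<open>D0\<close> within \<open>r\<close> of \<open>y\<close>: bounded in norm and with image in
    a compact set, hence finite in number.\<close>
  define F where "F = {f \<in> \<Gamma>'. s' f \<in> {k \<otimes>\<^bsub>H'\<^esub> inv\<^bsub>H'\<^esub> d |k d. k \<in> K' \<and> d \<in> A} \<and> norm f \<le> r}"
  have finF: "finite F"
    unfolding F_def by (rule M.finite_cut_project_cball[OF M.compactin_diff[OF K'(3) A]])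
  let ?G = "(\<lambda>f. (\<lambda>h. s' f \<otimes>\<^bsub>H'\<^esub> h) ` C0) ` F"
  have closedG: "closedin T' C" if C: "C \<in> ?G" for C
  proof -
    obtain f where f: "f \<in> F" "C = (\<lambda>h. s' f \<otimes>\<^bsub>H'\<^esub> h) ` C0" using C by blast
    have "s' f \<in> carrier H'" using f(1) M.s_closed by (simp add: F_def)
    then show ?thesis unfolding f(2) by (intro M.compactin_closedin M.compactin_image_mult C0)
  qed
  have B_cover: "B \<inter> s' ` \<Gamma>' \<subseteq> \<Union>?G"
  proof
    fix h assume "h \<in> B \<inter> s' ` \<Gamma>'"
    then obtain y where y: "y \<in> \<Gamma>'" "h = s' y" "s' y \<in> B" by blast
    obtain \<delta> where \<delta>: "\<delta> \<in> D0" "norm (y - \<delta>) \<le> r" using r by blast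
    have \<delta>\<Gamma>: "\<delta> \<in> \<Gamma>'" using D0_\<Gamma>'(1)[OF \<delta>(1)] .
    have c: "s' y \<in> carrier H'" "s' \<delta> \<in> carrier H'" using M.s_closed y(1) \<delta>\<Gamma> by auto
    have "s' (y - \<delta>) = s' y \<otimes>\<^bsub>H'\<^esub> inv\<^bsub>H'\<^esub> (s' \<delta>)"
      using M.s_diff[OF y(1) \<delta>\<Gamma>] c by (simp add: M.m_comm)
    moreover have "s' y \<in> K'" "s' \<delta> \<in> A" using y(3) K'(4) D0_A \<delta>(1) by auto
    ultimately have "y - \<delta> \<in> F"
      unfolding F_def using M.diff_\<Gamma>[OF y(1) \<delta>\<Gamma>] \<delta>(2) by blast
    moreover have "h = s' (y - \<delta>) \<otimes>\<^bsub>H'\<^esub> s' \<delta>"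
      using M.s_add[OF M.diff_\<Gamma>[OF y(1) \<delta>\<Gamma>] \<delta>\<Gamma>] y(2) by simp
    ultimately show "h \<in> \<Union>?G" using D0_C0 \<delta>(1) by blast
  qed
  have "closedin T' (\<Union>?G)" using finF closedG by (intro closedin_Union) auto
  \<comment> \<open>A closed set that contains all of the dense image lying in the open set
    \<open>B\<close> contains \<open>B\<close> itself.\<close>
  then have "openin T' (B - \<Union>?G)" using K'(1) by (intro openin_diff)
  moreover have "s' ` \<Gamma>' \<inter> (B - \<Union>?G) = {}" using B_cover by blast
  ultimately have "B - \<Union>?G = {}" using M.dense_range unfolding dense_intersects_open by blast
  then have "B \<subseteq> \<Union>?G" by blast
  moreover have "countable ?G" "B \<noteq> {}" using finF K'(2) by (auto intro: countable_finite)
  ultimately obtain C where C: "C \<in> ?G" "T' interior_of C \<noteq> {}"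
    using M.Baire_cover[OF _ closedG K'(1)] by metis
  then obtain f where f: "f \<in> F" "C = (\<lambda>h. s' f \<otimes>\<^bsub>H'\<^esub> h) ` C0" by blast
  have fc: "s' f \<in> carrier H'" using f(1) M.s_closed by (simp add: F_def)
  define O2 where "O2 = {h \<in> carrier H'. s' f \<otimes>\<^bsub>H'\<^esub> h \<in> T' interior_of C}"
  have O2: "openin T' O2" unfolding O2_def using fc by (intro M.openin_preimage_mult) auto
  have C0c: "C0 \<subseteq> carrier H'" using compactin_subset_topspace[OF C0] by simp
  have O2_C0: "O2 \<subseteq> C0"
  proof
    fix h assume h: "h \<in> O2"
    then have "s' f \<otimes>\<^bsub>H'\<^esub> h \<in> C" unfolding O2_def using subsetD[OF interior_of_subset[of T' C]] by simp
    then obtain k where "k \<in> C0" "s' f \<otimes>\<^bsub>H'\<^esub> h = s' f \<otimes>\<^bsub>H'\<^esub> k" using f(2) by blast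
    moreover have "h \<in> carrier H'" "k \<in> carrier H'" using h \<open>k \<in> C0\<close> C0c by (auto simp: O2_def)
    ultimately show "h \<in> C0" using fc by simp
  qed
  have "O2 \<noteq> {}"
  proof -
    obtain k where k: "k \<in> T' interior_of C" using C(2) by blast
    then have "k \<in> C" using subsetD[OF interior_of_subset[of T' C]] by blast
    then obtain h where "h \<in> C0" "k = s' f \<otimes>\<^bsub>H'\<^esub> h" using f(2) by blast
    then have "h \<in> O2" using k C0c unfolding O2_def by blast
    then show ?thesis by blast
  qed
  then obtain h where h: "h \<in> O2" by blast
  then have "h \<in> T' closure_of (s' ` D0)" using O2_C0 unfolding C0_def by blast
  \<comment> \<open>\<open>s' \<delta>\<close> is interior to \<open>C0\<close>. Translation by
    \<open>s' (\<gamma> - \<delta>)\<close> moves it to \<open>s' \<gamma>\<close> and moves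
    \<open>C0\<close> into \<open>W' i\<close>, because \<open>s (\<epsilon> - \<delta>)\<close> is
    in \<open>U\<close> for every \<epsilon> in \<open>D0\<close>.\<close>
  then obtain \<delta> where \<delta>: "\<delta> \<in> D0" "s' \<delta> \<in> O2" using O2 h unfolding in_closure_of by blast
  have \<delta>\<Gamma>: "\<delta> \<in> \<Gamma>'" using D0_\<Gamma>'(1)[OF \<delta>(1)] .
  have d: "\<delta> - \<gamma> \<in> \<Gamma>'" "\<gamma> - \<delta> \<in> \<Gamma>'" using M.diff_\<Gamma> \<delta>\<Gamma> \<gamma>c(3) by auto
  define O3 where "O3 = {h \<in> carrier H'. s' (\<delta> - \<gamma>) \<otimes>\<^bsub>H'\<^esub> h \<in> O2}"
  have "openin T' O3"
    unfolding O3_def by (rule M.openin_preimage_mult[OF O2 M.s_closed[OF d(1)]])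
  moreover have "O3 \<subseteq> W' i"
  proof
    have "C0 \<subseteq> {h \<in> carrier H'. s' (\<gamma> - \<delta>) \<otimes>\<^bsub>H'\<^esub> h \<in> W' i}"
      unfolding C0_def
    proof (rule closure_of_minimal)
      show "closedin T' {h \<in> carrier H'. s' (\<gamma> - \<delta>) \<otimes>\<^bsub>H'\<^esub> h \<in> W' i}"
        by (rule M.closedin_preimage_mult[OF M.compactin_closedin[OF compact_W'] M.s_closed[OF d(2)]])
      show "s' ` D0 \<subseteq> {h \<in> carrier H'. s' (\<gamma> - \<delta>) \<otimes>\<^bsub>H'\<^esub> h \<in> W' i}"
      proof (rule image_subsetI)
        fix \<epsilon> assume \<epsilon>: "\<epsilon> \<in> D0"
        have "s' (\<gamma> + (\<epsilon> - \<delta>)) \<in> W' i"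
          by (rule UW[OF diff_\<Gamma>[OF D0_\<Gamma>'(2)[OF \<epsilon>] D0_\<Gamma>'(2)[OF \<delta>(1)]] D0U[OF \<epsilon> \<delta>(1)]])
        moreover have "s' (\<gamma> + (\<epsilon> - \<delta>)) = s' (\<gamma> - \<delta>) \<otimes>\<^bsub>H'\<^esub> s' \<epsilon>"
          using M.s_add[OF d(2) D0_\<Gamma>'(1)[OF \<epsilon>]] by (simp add: algebra_simps)
        ultimately show "s' \<epsilon> \<in> {h \<in> carrier H'. s' (\<gamma> - \<delta>) \<otimes>\<^bsub>H'\<^esub> h \<in> W' i}"
          using M.s_closed[OF D0_\<Gamma>'(1)[OF \<epsilon>]] by simp
      qed
    qed
    moreover fix h assume h: "h \<in> O3"
    ultimately have "s' (\<gamma> - \<delta>) \<otimes>\<^bsub>H'\<^esub> (s' (\<delta> - \<gamma>) \<otimes>\<^bsub>H'\<^esub> h) \<in> W' i"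
      using O2_C0 unfolding O3_def by blast
    moreover have "h \<in> carrier H'" using h by (simp add: O3_def)
    moreover have "s' (\<gamma> - \<delta>) \<otimes>\<^bsub>H'\<^esub> s' (\<delta> - \<gamma>) = \<one>\<^bsub>H'\<^esub>"
      using M.s_add[OF d(2,1)] M.s_zero by simp
    ultimately show "h \<in> W' i"
      using M.m_assoc[of "s' (\<gamma> - \<delta>)" "s' (\<delta> - \<gamma>)" h] M.s_closed d by simp
  qed
  ultimately have "O3 \<subseteq> T' interior_of W' i" by (rule interior_of_maximal[rotated])
  moreover have "s' (\<delta> - \<gamma>) \<otimes>\<^bsub>H'\<^esub> s' \<gamma> = s' \<delta>"
    using M.s_add[OF d(1) \<gamma>c(3)] by simp
  then have "s' \<gamma> \<in> O3" unfolding O3_def using \<delta>(2) \<gamma>c by simp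
  ultimately show ?thesis by blast
qed

end

theorem theorem3p1:
  fixes \<Lambda> :: "'i::finite \<Rightarrow> 'a::euclidean_space set"
    and H :: "('i \<Rightarrow> 'a set) set monoid"
  assumes "meyer_multiple_set \<Lambda>"
    and "repetitive \<Lambda>"
    and "srp_group \<Lambda> H"
  shows "model_multiple_set TYPE(('i \<Rightarrow> 'a set) set) (lower_model \<Lambda> H) \<and>
    (\<forall>\<Delta> :: 'i \<Rightarrow> 'a set. model_multiple_set TYPE('h) \<Delta> \<longrightarrow> (\<forall>i. \<Lambda> i \<subseteq> \<Delta> i) \<longrightarrow>
       (\<forall>i. \<Lambda> i \<subseteq> lower_model \<Lambda> H i \<and> lower_model \<Lambda> H i \<subseteq> \<Delta> i))"
proof -
  have lcaH: "lca_group H (srp_topology \<Lambda>)" using assms(3) by (simp add: srp_group_def)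
  have S: "srp_cps \<Lambda> H"
    using assms lcaI[OF lcaH] unfolding meyer_multiple_set_def
    by (simp add: srp_cps_def srp_cps_axioms_def meyer_support_def)
  interpret srp_cps \<Lambda> H by (rule S)
  have "cut_project_set \<Gamma> s (srp_topology \<Lambda> interior_of srp_window \<Lambda> H i) \<subseteq> lower_model \<Lambda> H i \<and>
      lower_model \<Lambda> H i \<subseteq> cut_project_set \<Gamma> s (srp_window \<Lambda> H i)" for i
    using interior_of_subset[of "srp_topology \<Lambda>" "srp_window \<Lambda> H i"] s_window[of _ i]
    unfolding lower_model_def cut_project_set_def by blast
  then have "model_multiple_set TYPE(('i \<Rightarrow> 'a set) set) (lower_model \<Lambda> H)"
    unfolding model_multiple_set_def using cut_project_scheme_srp window_srp by blast
  moreover have "lower_model \<Lambda> H i \<subseteq> \<Delta> i"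
    if \<Delta>: "model_multiple_set TYPE('h) \<Delta>" "\<forall>i. \<Lambda> i \<subseteq> \<Delta> i" for \<Delta> :: "'i \<Rightarrow> 'a set" and i
  proof -
    obtain H' :: "'h monoid" and T' \<Gamma>' s' W' where
      c: "cut_project_scheme H' T' \<Gamma>' s'" "window T' W'"
      and W: "\<And>i. cut_project_set \<Gamma>' s' (T' interior_of W' i) \<subseteq> \<Delta> i"
        "\<And>i. \<Delta> i \<subseteq> cut_project_set \<Gamma>' s' (W' i)"
      using \<Delta>(1) unfolding model_multiple_set_def by blast
    have "lca H' T'" using c(1) lcaI unfolding cut_project_scheme_def by blast
    then have "srp_cps_extension \<Lambda> H H' T' \<Gamma>' s' W'"
      using S c W(2) \<Delta>(2)
      unfolding srp_cps_extension_def srp_cps_extension_axioms_def cps_def cps_axioms_def by blast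
    then interpret E: srp_cps_extension \<Lambda> H H' T' \<Gamma>' s' W' .
    \<comment> \<open>The points over the interior of the window are handled by
      \<open>s'_window_interior\<close>, those of \<Lambda> by the hypothesis on \<Delta>.\<close>
    show ?thesis
      using W(1)[of i] \<Delta>(2) E.s'_window_interior E.\<Gamma>_\<Gamma>'
      unfolding lower_model_def cut_project_set_def by blast
  qed
  ultimately show ?thesis unfolding lower_model_def by blast
qed

end
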